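(* For $n\ge 1$ let $\mathcal{C}_n=\{A^2 : A\in \mathrm{Mat}_n(\mathbb{F}_2)\}\subseteq \mathrm{Mat}_n(\mathbb{F}_2)$ be the set of squares of elements of $\mathrm{Mat}_n(\mathbb{F}_2)$. Then $\mathcal{C}_n$ is a union of conjugacy classes, and the sequence $(\mathcal{C}_n)_{n\ge1}$ is partition uniform with respect to $$\mathcal{S}=\{\lambda\in\mathcal{P} : m_{2i-1}(\lambda')\le 1 \text{ for all } i\ge 1\}\cup\{\emptyset\}.$$ That is, for every $n\ge 1$, the functions $\Lambda:\mathcal{I}(2)\to\mathcal{P}$ which specify the conjugacy classes contained in $\mathcal{C}_n$ are exactly the functions $\Lambda$ (with $\Lambda(\phi)=\emptyset$ for all but finitely many $\phi$) such that $\dim\Lambda=n$ and $\Lambda(\phi)\in\mathcal{S}$ for all $\phi\in\mathcal{I}(2)$.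
   Context: $\mathrm{Mat}_n(K)$ is the ring of $n\times n$ matrices over a field $K$; two matrices $A,B\in\mathrm{Mat}_n(K)$ are similar, $A\sim B$, if $A=U^{-1}BU$ for some invertible $U\in\mathrm{Mat}_n(K)$, and a conjugacy class is an equivalence class for this relation. A partition is a non-increasing sequence $\lambda=(\lambda_1,\lambda_2,\dots)$ of nonnegative integers with all but finitely many $\lambda_i=0$; $\emptyset$ is the empty (all-zero) partition, and $\mathcal{P}$ is the set of all partitions. The weight is $|\lambda|=\sum_i\lambda_i$. The conjugate $\lambda'$ is given by $\lambda'_j=\#\{i : \lambda_i\ge j\}$ for $j\ge1$. For $i\ge1$ the multiplicity is $m_i(\lambda)=\#\{j : \lambda_j=i\}$. For a prime power $q$, $\mathcal{I}(q)$ is the set of monic irreducible polynomials over $\mathbb{F}_q$. For a monic polynomial $\phi(X)$, $M(\phi)$ is its companion matrix (the matrix of multiplication by $X$ on polynomials modulo $\phi$ with respect to the basis $1,X,\dots,X^{\deg\phi-1}$), and $M(1)$ is the $0\times0$ matrix. By rational canonical form, each conjugacy class of $\mathrm{Mat}_n(\mathbb{F}_q)$ is uniquely specified by a function $\Lambda:\mathcal{I}(q)\to\mathcal{P}$ with $\Lambda(\phi)=\emptyset$ for all but finitely many $\phi$ and $\dim\Lambda:=\sum_{\phi}|\Lambda(\phi)|\deg(\phi)=n$; the class specified by $\Lambda$ is that of the matrix $\bigoplus_{\phi\in\mathcal{I}(q)}\bigoplus_i M(\phi^{\Lambda(\phi)_i})$. *)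

theory Defs
  imports "Jordan_Normal_Form.Matrix" "HOL-Library.Z2" "HOL-Library.FuncSet"
    "HOL-Computational_Algebra.Polynomial_Factorial"
begin

(* Sequences are indexed from 0: the value at i is the (i + 1)st term. *)

definition partitions :: "(nat \<Rightarrow> nat) set" where
  "partitions = {p. antimono p \<and> finite {i. p i \<noteq> 0}}"

definition empty_partition :: "nat \<Rightarrow> nat" where
  "empty_partition = (\<lambda>_. 0)"

definition weight :: "(nat \<Rightarrow> nat) \<Rightarrow> nat" where
  "weight p = (\<Sum>i\<in>{i. p i \<noteq> 0}. p i)"

definition conjugate_partition :: "(nat \<Rightarrow> nat) \<Rightarrow> nat \<Rightarrow> nat" where
  "conjugate_partition p j = card {i. Suc j \<le> p i}"

(* Meaningful for i > 0 only: a partition has infinitely many zero terms. *)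
definition multiplicity_of :: "nat \<Rightarrow> (nat \<Rightarrow> nat) \<Rightarrow> nat" where
  "multiplicity_of i p = card {j. p j = i}"

definition num_parts :: "(nat \<Rightarrow> nat) \<Rightarrow> nat" where
  "num_parts p = card {i. p i \<noteq> 0}"

definition monic_irreducibles :: "'a :: field poly set" where
  "monic_irreducibles = {\<phi>. lead_coeff \<phi> = 1 \<and> irreducible \<phi>}"

(* Column j holds the coordinates of X * X^j modulo phi. *)
definition companion_matrix :: "'a :: field poly \<Rightarrow> 'a mat" where
  "companion_matrix \<phi> =
     mat (degree \<phi>) (degree \<phi>) (\<lambda>(i, j). coeff ((monom 1 1 * monom 1 j) mod \<phi>) i)"

definition nonempty_at :: "('a :: field poly \<Rightarrow> nat \<Rightarrow> nat) \<Rightarrow> 'a poly set" where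
  "nonempty_at \<Lambda> = {\<phi> \<in> monic_irreducibles. \<Lambda> \<phi> \<noteq> empty_partition}"

(* A function on the monic irreducible polynomials is represented by its extensional version,
   so that equality of such functions is equality in HOL. *)
definition class_data :: "('a :: field poly \<Rightarrow> nat \<Rightarrow> nat) set" where
  "class_data = {\<Lambda> \<in> monic_irreducibles \<rightarrow>\<^sub>E partitions. finite (nonempty_at \<Lambda>)}"

definition dim_data :: "('a :: field poly \<Rightarrow> nat \<Rightarrow> nat) \<Rightarrow> nat" where
  "dim_data \<Lambda> = (\<Sum>\<phi>\<in>nonempty_at \<Lambda>. weight (\<Lambda> \<phi>) * degree \<phi>)"

definition blocks :: "('a :: field poly \<Rightarrow> nat \<Rightarrow> nat) \<Rightarrow> 'a poly \<Rightarrow> 'a mat list" where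
  "blocks \<Lambda> \<phi> = map (\<lambda>i. companion_matrix (\<phi> ^ \<Lambda> \<phi> i)) [0..<num_parts (\<Lambda> \<phi>)]"

(* The direct sum of the blocks, one matrix for each ordering of the support (these matrices are
   all similar). Terms that are omitted would contribute the 0 x 0 matrix. *)
definition canonical_matrices :: "('a :: field poly \<Rightarrow> nat \<Rightarrow> nat) \<Rightarrow> 'a mat set" where
  "canonical_matrices \<Lambda> =
     {diag_block_mat (concat (map (blocks \<Lambda>) \<phi>s)) | \<phi>s. distinct \<phi>s \<and> set \<phi>s = nonempty_at \<Lambda>}"

definition similarity :: "nat \<Rightarrow> ('a :: field mat \<times> 'a mat) set" where
  "similarity n = {(A, B). A \<in> carrier_mat n n \<and> B \<in> carrier_mat n n \<and> similar_mat A B}"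

definition conjugacy_classes :: "nat \<Rightarrow> 'a :: field mat set set" where
  "conjugacy_classes n = carrier_mat n n // similarity n"

definition specifies :: "('a :: field poly \<Rightarrow> nat \<Rightarrow> nat) \<Rightarrow> 'a mat set \<Rightarrow> bool" where
  "specifies \<Lambda> K \<longleftrightarrow> (\<exists>A \<in> canonical_matrices \<Lambda>. A \<in> K)"

definition union_of_conjugacy_classes :: "nat \<Rightarrow> 'a :: field mat set \<Rightarrow> bool" where
  "union_of_conjugacy_classes n C \<longleftrightarrow> (\<exists>\<K> \<subseteq> conjugacy_classes n. C = \<Union>\<K>)"

definition partition_uniform :: "(nat \<Rightarrow> 'a :: field mat set) \<Rightarrow> (nat \<Rightarrow> nat) set \<Rightarrow> bool" where
  "partition_uniform C S \<longleftrightarrow>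
     (\<forall>n\<ge>1. {\<Lambda> \<in> class_data. \<exists>K \<in> conjugacy_classes n. K \<subseteq> C n \<and> specifies \<Lambda> K} =
             {\<Lambda> \<in> class_data. dim_data \<Lambda> = n \<and> (\<forall>\<phi> \<in> monic_irreducibles. \<Lambda> \<phi> \<in> S)})"

definition squares_of_matrices :: "nat \<Rightarrow> 'a :: field mat set" where
  "squares_of_matrices n = {A ^\<^sub>m 2 | A. A \<in> carrier_mat n n}"

end

theory Submission
  imports Defs "Jordan_Normal_Form.Determinant"
begin

text \<open>
  Fix an irreducible polynomial \<open>\<phi>\<close> of degree \<open>d\<close> over the field with two elements, and let
  \<open>\<lambda>\<close> be the partition that a matrix \<open>A\<close> has at \<open>\<phi>\<close>. The conjugate of \<open>\<lambda>\<close> is visible in the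
  kernels of the powers of \<open>\<phi>(A)\<close>: from the kernel of \<open>\<phi>(A)^j\<close> to that of \<open>\<phi>(A)^(j+1)\<close> the
  dimension grows by \<open>d\<close> times the \<open>j\<close>-th part of the conjugate (counted from 0).
  As the field is finite, sizes of kernels can stand for their dimensions.

  Everything rests on the Frobenius identity \<open>p(X\<^sup>2) = p(X)\<^sup>2\<close>, which gives \<open>p(B\<^sup>2) = p(B)\<^sup>2\<close>.

  If \<open>A = B\<^sup>2\<close>, then the kernel of \<open>\<phi>(A)^j\<close> is that of \<open>\<phi>(B)^(2j)\<close>. For an arbitrary matrix
  \<open>B\<close> the kernels of the powers of \<open>\<phi>(B)\<close> grow by \<open>d * e 0, d * e 1, \<dots>\<close> with \<open>e\<close> non-increasing
  (\<open>card_poly_kernel_power_Suc\<close>): each quotient of successive kernels is a vector space over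
  the field of polynomials modulo \<open>\<phi>\<close>, and \<open>\<phi>(B)\<close> embeds it into the preceding quotient.
  The \<open>j\<close>-th part of the conjugate of \<open>\<lambda>\<close> is
  \<open>e (2 * j) + e (2 * j + 1)\<close>. If two of these sums agree, monotonicity makes all four terms equal,
  so the common value is even: an odd number occurs at most once.

  Conversely, the multiplicity of \<open>2 * i + 1\<close> in the conjugate of \<open>\<lambda>\<close> is the difference of the parts
  \<open>2 * i\<close> and \<open>2 * i + 1\<close> of \<open>\<lambda>\<close>, again counted from 0. If it is at most 1 for all \<open>i\<close>, the
  blocks at \<open>\<phi>\<close> fall into consecutive pairs belonging to \<open>\<phi>^a\<close> and \<open>\<phi>^b\<close> with
  \<open>b \<le> a \<le> b + 1\<close>. Such a pair is similar to the square of the companion matrix of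
  \<open>\<phi>^(a + b)\<close> (\<open>companion_pair_is_square\<close>) through the linear map
  \<open>(f, g) \<mapsto> f\<^sup>2 + \<phi> g\<^sup>2\<close>. It turns multiplication by \<open>X\<close> into multiplication by \<open>X\<^sup>2\<close>, and it
  is injective because \<open>\<phi>\<close> divides \<open>f\<^sup>2\<close> to an even and \<open>\<phi> g\<^sup>2\<close> to an odd order, so that no
  cancellation can occur. Direct sums of squares are squares, and squares are closed under similarity.
\<close>

section \<open>Polynomials of bounded degree as vectors\<close>

text \<open>
  Written with coefficients instead of degrees, so that the zero polynomial is not a special case when \<open>n = 0\<close>.
\<close>
definition polys_below :: "nat \<Rightarrow> 'a :: zero poly set" where
  "polys_below n = {f. \<forall>i\<ge>n. coeff f i = 0}"

definition vec_of_poly :: "nat \<Rightarrow> 'a :: zero poly \<Rightarrow> 'a vec" where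
  "vec_of_poly n f = vec n (coeff f)"

lemma polys_below_iff: "f \<in> polys_below n \<longleftrightarrow> f = 0 \<or> degree f < n"
proof
  assume "f \<in> polys_below n"
  then have "f = 0 \<or> \<not> n \<le> degree f"
    unfolding polys_below_def using leading_coeff_0_iff by blast
  then show "f = 0 \<or> degree f < n" by auto
qed (auto simp: polys_below_def coeff_eq_0)

lemma zero_polys_below [simp]: "0 \<in> polys_below n"
  by (simp add: polys_below_def)

lemma add_polys_below:
  "f \<in> polys_below n \<Longrightarrow> g \<in> polys_below n \<Longrightarrow> (f + g :: 'a :: comm_monoid_add poly) \<in> polys_below n"
  by (simp add: polys_below_def)

lemma mod_polys_below:
  fixes f :: "'a :: field poly"
  assumes "p \<noteq> 0"
  shows "f mod p \<in> polys_below (degree p)"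
  using degree_mod_less[OF assms] by (auto simp: polys_below_iff)

lemma mod_eq_self_polys_below:
  fixes f :: "'a :: field poly"
  shows "f \<in> polys_below (degree p) \<Longrightarrow> f mod p = f"
  by (auto simp: polys_below_iff mod_poly_less)

lemma polys_below_dvd_zero:
  fixes f :: "'a :: field poly"
  shows "f \<in> polys_below (degree p) \<Longrightarrow> p dvd f \<Longrightarrow> f = 0"
  using mod_eq_self_polys_below[of f p] by auto

lemma vec_of_poly_carrier [simp]: "vec_of_poly n f \<in> carrier_vec n"
  by (simp add: vec_of_poly_def)

lemma dim_vec_of_poly [simp]: "dim_vec (vec_of_poly n f) = n"
  by (simp add: vec_of_poly_def)

lemma vec_of_poly_add:
  "vec_of_poly n (f + g) = vec_of_poly n f + vec_of_poly n (g :: 'a :: comm_monoid_add poly)"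
  by (auto simp: vec_of_poly_def)

lemma vec_of_poly_smult:
  "vec_of_poly n (smult c f) = c \<cdot>\<^sub>v vec_of_poly n (f :: 'a :: comm_semiring_0 poly)"
  by (auto simp: vec_of_poly_def)

lemma vec_of_poly_0 [simp]: "vec_of_poly n 0 = 0\<^sub>v n"
  by (auto simp: vec_of_poly_def)

lemma bij_betw_vec_of_poly:
  "bij_betw (vec_of_poly n) (polys_below n :: 'a :: zero poly set) (carrier_vec n)"
proof (rule bij_betw_imageI)
  show "inj_on (vec_of_poly n) (polys_below n :: 'a poly set)"
  proof (rule inj_onI)
    fix f g :: "'a poly"
    assume f: "f \<in> polys_below n" and g: "g \<in> polys_below n"
      and eq: "vec_of_poly n f = vec_of_poly n g"
    have "coeff f i = coeff g i" for i
    proof (cases "i < n")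
      case True
      then show ?thesis using arg_cong[OF eq, of "\<lambda>v. v $ i"] by (simp add: vec_of_poly_def)
    qed (use f g in \<open>simp add: polys_below_def\<close>)
    then show "f = g" by (simp add: poly_eq_iff)
  qed
  show "vec_of_poly n ` (polys_below n :: 'a poly set) = carrier_vec n"
  proof (intro equalityI subsetI)
    fix v :: "'a vec" assume v: "v \<in> carrier_vec n"
    show "v \<in> vec_of_poly n ` polys_below n"
    proof (rule image_eqI)
      let ?f = "Abs_poly (\<lambda>i. if i < n then v $ i else 0)"
      have "\<forall>\<^sub>\<infinity>i. (if i < n then v $ i else 0) = 0"
        by (auto simp: MOST_nat intro!: exI[of _ n])
      then have "coeff ?f = (\<lambda>i. if i < n then v $ i else 0)"
        by (intro Abs_poly_inverse) simp
      then show "v = vec_of_poly n ?f" "?f \<in> polys_below n"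
        using v by (auto simp: vec_of_poly_def polys_below_def)
    qed
  qed auto
qed

lemma carrier_vec_cases:
  assumes "v \<in> carrier_vec n"
  obtains f where "f \<in> polys_below n" "v = vec_of_poly n f"
  using assms bij_betw_imp_surj_on[OF bij_betw_vec_of_poly, of n] by blast

lemma vec_of_poly_eq_0_iff: "f \<in> polys_below n \<Longrightarrow> vec_of_poly n f = 0\<^sub>v n \<longleftrightarrow> f = 0"
  using bij_betw_imp_inj_on[OF bij_betw_vec_of_poly, of n] inj_onD[of "vec_of_poly n" _ f 0]
  by fastforce

lemma sum_monom_polys_below:
  assumes "f \<in> polys_below n"
  shows "f = (\<Sum>j<n. monom (coeff f j) j)"
  using assms by (auto simp: poly_eq_iff coeff_sum polys_below_def if_distrib sum.delta cong: if_cong)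

section \<open>Matrices of linear maps between spaces of polynomials\<close>

definition linear_poly_map :: "('a :: comm_ring_1 poly \<Rightarrow> 'a poly) \<Rightarrow> bool" where
  "linear_poly_map L \<longleftrightarrow> (\<forall>f g. L (f + g) = L f + L g) \<and> (\<forall>c f. L (smult c f) = smult c (L f))"

definition matrix_of_poly_map :: "nat \<Rightarrow> nat \<Rightarrow> ('a :: comm_ring_1 poly \<Rightarrow> 'a poly) \<Rightarrow> 'a mat" where
  "matrix_of_poly_map m n L = mat m n (\<lambda>(i, j). coeff (L (monom 1 j)) i)"

lemma matrix_of_poly_map_carrier [simp]: "matrix_of_poly_map m n L \<in> carrier_mat m n"
  by (simp add: matrix_of_poly_map_def)

text \<open>
  Lets companion matrices, and below the base change between two matrices, be handled as linear
  maps on polynomials without reference to entries.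
\<close>
lemma matrix_of_poly_map_mult:
  assumes L: "linear_poly_map L" and f: "f \<in> polys_below n"
  shows "matrix_of_poly_map m n L *\<^sub>v vec_of_poly n f = vec_of_poly m (L f)"
proof (rule eq_vecI)
  have add: "L (f + g) = L f + L g" and sm: "L (smult c f) = smult c (L f)" for f g c
    using L by (auto simp: linear_poly_map_def)
  have zero: "L 0 = 0" using sm[of 0 0] by simp
  have Lsum: "L (\<Sum>j\<in>S. h j) = (\<Sum>j\<in>S. L (h j))" if "finite S" for S and h :: "nat \<Rightarrow> _"
    using that by induction (simp_all add: zero add)
  have "L f = (\<Sum>j<n. L (smult (coeff f j) (monom 1 j)))"
    by (subst sum_monom_polys_below[OF f]) (simp add: Lsum smult_monom)
  also have "\<dots> = (\<Sum>j<n. smult (coeff f j) (L (monom 1 j)))" by (simp only: sm)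
  finally have Lf: "L f = (\<Sum>j<n. smult (coeff f j) (L (monom 1 j)))" .
  fix i assume "i < dim_vec (vec_of_poly m (L f))"
  then show "(matrix_of_poly_map m n L *\<^sub>v vec_of_poly n f) $ i = vec_of_poly m (L f) $ i"
    by (subst Lf) (auto simp: matrix_of_poly_map_def vec_of_poly_def scalar_prod_def coeff_sum
        atLeast0LessThan mult.commute intro!: sum.cong)
qed (simp add: matrix_of_poly_map_def)

lemma mat_eqI_mult_vec:
  fixes A B :: "'a :: comm_ring_1 mat"
  assumes A: "A \<in> carrier_mat m n" and B: "B \<in> carrier_mat m n"
    and eq: "\<And>v. v \<in> carrier_vec n \<Longrightarrow> A *\<^sub>v v = B *\<^sub>v v"
  shows "A = B"
proof (rule eq_matI)
  fix i j assume "i < dim_row B" "j < dim_col B"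
  then have ij: "i < m" "j < n" using B by auto
  have "(A *\<^sub>v unit_vec n j) $ i = (B *\<^sub>v unit_vec n j) $ i" using eq by simp
  then show "A $$ (i, j) = B $$ (i, j)" using A B ij by simp
qed (use A B in auto)

lemma linear_poly_map_mult_mod:
  "linear_poly_map (\<lambda>f. (g * f) mod (p :: 'a :: field poly))"
  by (simp add: linear_poly_map_def distrib_left poly_mod_add_left mod_smult_left)

lemma companion_matrix_carrier [simp]:
  "companion_matrix p \<in> carrier_mat (degree p) (degree p)"
  by (simp add: companion_matrix_def)

lemma companion_matrix_mult:
  assumes "f \<in> polys_below (degree p)"
  shows "companion_matrix p *\<^sub>v vec_of_poly (degree p) f =
    vec_of_poly (degree p) ((monom 1 1 * f) mod p)"
proof -
  have "companion_matrix p = matrix_of_poly_map (degree p) (degree p) (\<lambda>f. (monom 1 1 * f) mod p)"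
    by (simp add: companion_matrix_def matrix_of_poly_map_def)
  then show ?thesis using matrix_of_poly_map_mult[OF linear_poly_map_mult_mod assms] by simp
qed

section \<open>The action of polynomials on vectors\<close>

text \<open>
  Horner evaluation of \<open>p(A) v\<close>. Acting on vectors directly avoids computing in the ring of
  matrices.
\<close>
definition poly_act :: "'a :: comm_ring_1 mat \<Rightarrow> 'a poly \<Rightarrow> 'a vec \<Rightarrow> 'a vec" where
  "poly_act A p v = fold_coeffs (\<lambda>c w. c \<cdot>\<^sub>v v + A *\<^sub>v w) p (0\<^sub>v (dim_vec v))"

context
  fixes A :: "'a :: comm_ring_1 mat" and n :: nat
  assumes A: "A \<in> carrier_mat n n"
begin

lemma poly_act_0: "v \<in> carrier_vec n \<Longrightarrow> poly_act A 0 v = 0\<^sub>v n"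
  by (simp add: poly_act_def)

lemma poly_act_pCons:
  assumes v: "v \<in> carrier_vec n"
  shows "poly_act A (pCons a p) v = a \<cdot>\<^sub>v v + A *\<^sub>v poly_act A p v"
proof -
  have "0 \<cdot>\<^sub>v v + A *\<^sub>v 0\<^sub>v n = 0\<^sub>v n" using A v by (intro eq_vecI) auto
  then show ?thesis
    using v by (cases "p = 0"; cases "a = 0") (auto simp: poly_act_def)
qed

lemma poly_act_carrier: "v \<in> carrier_vec n \<Longrightarrow> poly_act A p v \<in> carrier_vec n"
  using A by (induction p) (simp_all add: poly_act_0 poly_act_pCons)

lemma poly_act_const:
  assumes v: "v \<in> carrier_vec n"
  shows "poly_act A [:a:] v = a \<cdot>\<^sub>v v"
proof -
  have "A *\<^sub>v 0\<^sub>v n = 0\<^sub>v n" using A by (intro eq_vecI) auto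
  then show ?thesis using v by (simp add: poly_act_pCons poly_act_0)
qed

lemma poly_act_1: "v \<in> carrier_vec n \<Longrightarrow> poly_act A 1 v = v"
  using poly_act_const[of v 1] by (simp add: one_pCons)

lemma poly_act_X:
  assumes v: "v \<in> carrier_vec n"
  shows "poly_act A (pCons 0 p) v = A *\<^sub>v poly_act A p v"
proof -
  have "0 \<cdot>\<^sub>v v + w = w" if "w \<in> carrier_vec n" for w
    using v that by (intro eq_vecI) auto
  then show ?thesis using A v by (simp add: poly_act_pCons poly_act_carrier)
qed

lemma poly_act_add_vec:
  assumes "v \<in> carrier_vec n" "w \<in> carrier_vec n"
  shows "poly_act A p (v + w) = poly_act A p v + poly_act A p w"
proof (induction p)
  case 0 then show ?case using assms by (simp add: poly_act_0)
next
  case (pCons a p)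
  have *: "(x + y) + (z + u) = (x + z) + (y + u)"
    if "x \<in> carrier_vec n" "y \<in> carrier_vec n" "z \<in> carrier_vec n" "u \<in> carrier_vec n"
    for x y z u :: "'a vec"
    using that by (intro eq_vecI) (auto simp: algebra_simps)
  show ?case
    using assms A
    by (simp add: poly_act_pCons pCons.IH smult_add_distrib_vec[of _ n]
        mult_add_distrib_mat_vec[OF A] poly_act_carrier * del: assoc_add_vec)
qed

lemma poly_act_zero_vec: "poly_act A p (0\<^sub>v n) = 0\<^sub>v n"
  using A by (induction p) (auto simp: poly_act_0 poly_act_pCons)

lemma poly_act_add:
  assumes v: "v \<in> carrier_vec n"
  shows "poly_act A (p + q) v = poly_act A p v + poly_act A q v"
proof (induction p q rule: poly_induct2)
  case 0 then show ?case using v by (simp add: poly_act_0)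
next
  case (pCons a p b q)
  have *: "(x + y) + (z + u) = (x + z) + (y + u)"
    if "x \<in> carrier_vec n" "y \<in> carrier_vec n" "z \<in> carrier_vec n" "u \<in> carrier_vec n"
    for x y z u :: "'a vec"
    using that by (intro eq_vecI) (auto simp: algebra_simps)
  show ?case
    using v A
    by (simp add: poly_act_pCons pCons.IH add_smult_distrib_vec
        mult_add_distrib_mat_vec[OF A] poly_act_carrier * del: assoc_add_vec)
qed

lemma poly_act_smult:
  assumes v: "v \<in> carrier_vec n"
  shows "poly_act A (smult c p) v = c \<cdot>\<^sub>v poly_act A p v"
proof (induction p)
  case 0 then show ?case using v by (auto simp: poly_act_0)
next
  case (pCons a p)
  have "A *\<^sub>v (c \<cdot>\<^sub>v w) = c \<cdot>\<^sub>v (A *\<^sub>v w)" if "w \<in> carrier_vec n" for w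
    using A that by (intro eq_vecI) auto
  then show ?case
    using v A by (simp add: poly_act_pCons pCons.IH poly_act_carrier
        smult_add_distrib_vec[of _ n] smult_smult_assoc)
qed

lemma poly_act_mult:
  assumes v: "v \<in> carrier_vec n"
  shows "poly_act A (p * q) v = poly_act A p (poly_act A q v)"
proof (induction p)
  case 0 then show ?case using v by (simp add: poly_act_0 poly_act_carrier)
next
  case (pCons a p)
  then show ?case
    using v poly_act_pCons[OF poly_act_carrier[OF v]]
    by (simp add: poly_act_carrier poly_act_add poly_act_smult poly_act_X)
qed

end

lemma poly_act_square_mat:
  fixes A :: "'a :: comm_ring_1 mat"
  assumes A: "A \<in> carrier_mat n n" and v: "v \<in> carrier_vec n"
  shows "poly_act (A * A) p v = poly_act A (pcompose p (monom 1 2)) v"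
proof (induction p)
  case 0 then show ?case using v A by (simp add: poly_act_def)
next
  case (pCons a p)
  have AA: "A * A \<in> carrier_mat n n" using A by simp
  have m: "monom (1 :: 'a) 2 * q = pCons 0 (pCons 0 q)" for q
    by (simp add: monom_altdef power2_eq_square)
  let ?q = "pcompose p (monom 1 2)"
  have "poly_act A (pcompose (pCons a p) (monom 1 2)) v = a \<cdot>\<^sub>v v + A *\<^sub>v (A *\<^sub>v poly_act A ?q v)"
    by (simp only: pcompose_pCons m poly_act_add[OF A v] poly_act_const[OF A v] poly_act_X[OF A v])
  then show ?case
    using v A by (simp add: poly_act_pCons[OF AA] pCons.IH poly_act_carrier[OF A]
        assoc_mult_mat_vec[of A n n])
qed

lemma poly_act_four_block:
  fixes A D :: "'a :: comm_ring_1 mat"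
  assumes A: "A \<in> carrier_mat n n" and D: "D \<in> carrier_mat m m"
    and v: "v \<in> carrier_vec n" and w: "w \<in> carrier_vec m"
  shows "poly_act (four_block_mat A (0\<^sub>m n m) (0\<^sub>m m n) D) p (v @\<^sub>v w) =
    poly_act A p v @\<^sub>v poly_act D p w"
proof (induction p)
  case 0 
  have "v @\<^sub>v w \<in> carrier_vec (n + m)" using v w by simp
  then show ?case using v w A D 
    by (auto simp: poly_act_def)
next
  case (pCons a p)
  let ?M = "four_block_mat A (0\<^sub>m n m) (0\<^sub>m m n) D"
  have M: "?M \<in> carrier_mat (n + m) (n + m)" using A D by simp
  have vw: "v @\<^sub>v w \<in> carrier_vec (n + m)" using v w by simp
  have smult: "a \<cdot>\<^sub>v (v @\<^sub>v w) = a \<cdot>\<^sub>v v @\<^sub>v a \<cdot>\<^sub>v w" by (intro eq_vecI) auto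
  have pA: "poly_act A p v \<in> carrier_vec n" and pD: "poly_act D p w \<in> carrier_vec m"
    using poly_act_carrier A D v w by blast+
  show ?case
    using mult_mat_vec_split[OF A D pA pD] v w A D pA pD
    by (simp add: poly_act_pCons[OF M vw] poly_act_pCons[OF A v] poly_act_pCons[OF D w] pCons.IH
        smult append_vec_add[of _ n _ _ m])
qed

text \<open>
  The companion matrix of \<open>p\<close> is multiplication by \<open>X\<close> modulo \<open>p\<close>, so a polynomial in it is
  multiplication by that polynomial.
\<close>
lemma poly_act_companion:
  assumes p: "(p :: 'a :: field poly) \<noteq> 0" and f: "f \<in> polys_below (degree p)"
  shows "poly_act (companion_matrix p) q (vec_of_poly (degree p) f) =
    vec_of_poly (degree p) ((q * f) mod p)"
proof (induction q)
  case 0 then show ?case by (simp add: poly_act_def)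
next
  case (pCons a q)
  have "(pCons a q * f) mod p = smult a f + (monom 1 1 * ((q * f) mod p)) mod p"
    using mod_eq_self_polys_below[OF f] mod_mult_right_eq[of "[:0, 1:]" "q * f" p]
    by (simp add: poly_mod_add_left mod_smult_left monom_Suc)
  then show ?case
    by (simp add: poly_act_pCons[OF companion_matrix_carrier] pCons.IH companion_matrix_mult
        mod_polys_below p vec_of_poly_add vec_of_poly_smult)
qed

section \<open>Polynomials and vectors over the field with two elements\<close>

text \<open>
  The simplifier would turn field arithmetic on bits into bit operations, out of reach of the field laws.
\<close>

declare add_bit_eq_xor [simp del] mult_bit_eq_and [simp del]

lemma two_bit_poly: "(2 :: bit poly) = 0"
  by (simp add: numeral_poly)

lemma bit_poly_add_self: "f + f = (0 :: bit poly)"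
  by (simp only: mult_2[symmetric] two_bit_poly mult_zero_left)

lemma bit_poly_diff: "f - g = f + (g :: bit poly)"
  by (simp only: diff_eq_eq add.assoc bit_poly_add_self add_0_right)

lemma bit_poly_power2_add: "(f + g)\<^sup>2 = f\<^sup>2 + (g\<^sup>2 :: bit poly)"
  by (simp add: power2_sum two_bit_poly)

text \<open>
  The Frobenius identity: squaring is additive, and it fixes the coefficients.
\<close>
lemma pcompose_square_bit: "pcompose p (monom 1 2) = (p :: bit poly)\<^sup>2"
proof (induction p)
  case (pCons a p)
  have "pCons a p = [:a:] + monom 1 1 * p" by (simp add: monom_Suc)
  then have "(pCons a p)\<^sup>2 = [:a:]\<^sup>2 + (monom 1 1 * p)\<^sup>2"
    using bit_poly_power2_add by metis
  also have "[:a:]\<^sup>2 = [:a:]" by (cases a) (simp_all add: power2_eq_square)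
  also have "(monom 1 1 * p)\<^sup>2 = monom 1 2 * p\<^sup>2"
    by (simp add: power_mult_distrib monom_power)
  finally show ?case by (simp add: pcompose_pCons pCons.IH)
qed simp

lemma bit_vec_add_swap:
  fixes w x w' x' :: "bit vec"
  assumes "w + x = w' + x'"
    and "w \<in> carrier_vec n" "x \<in> carrier_vec n" "w' \<in> carrier_vec n" "x' \<in> carrier_vec n"
  shows "w + w' = x + x'"
proof (rule eq_vecI)
  fix i assume i: "i < dim_vec (x + x')"
  have "(w + x) $ i = (w' + x') $ i" by (simp only: assms(1))
  then have "w $ i + x $ i = w' $ i + x' $ i" using assms(2-5) i by simp
  then have "w $ i + w' $ i = x $ i + x' $ i"
    by (cases "w $ i"; cases "x $ i"; cases "w' $ i"; cases "x' $ i") simp_all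
  then show "(w + w') $ i = (x + x') $ i"
    using assms(2-5) i by simp
qed (use assms(2-5) in auto)

lemma bit_vec_add_self: "v \<in> carrier_vec n \<Longrightarrow> v + v = (0\<^sub>v n :: bit vec)"
  by (intro eq_vecI) auto

lemma bit_vec_add_eq_0:
  assumes "v \<in> carrier_vec n" "w \<in> carrier_vec n" "v + w = (0\<^sub>v n :: bit vec)"
  shows "v = w"
proof (rule eq_vecI)
  fix i assume i: "i < dim_vec w"
  have "(v + w) $ i = 0\<^sub>v n $ i" by (simp only: assms(3))
  then have "v $ i + w $ i = 0" using assms(1,2) i by simp
  then show "v $ i = w $ i" by (cases "v $ i"; cases "w $ i") auto
qed (use assms(1,2) in auto)

lemma polys_below_Suc:
  "polys_below (Suc n) = (\<lambda>(a, f). pCons a f) ` (UNIV \<times> polys_below n)"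
proof (intro equalityI subsetI)
  fix f :: "'a poly" assume f: "f \<in> polys_below (Suc n)"
  obtain a g where g: "f = pCons a g" by (rule pCons_cases)
  then have "coeff g i = 0" if "n \<le> i" for i
    using f that by (auto simp: polys_below_def dest!: spec[of _ "Suc i"])
  then show "f \<in> (\<lambda>(a, f). pCons a f) ` (UNIV \<times> polys_below n)"
    using g by (auto simp: polys_below_def)
qed (auto simp: polys_below_def coeff_pCons split: nat.splits)

lemma card_polys_below: "finite (polys_below n :: bit poly set) \<and> card (polys_below n :: bit poly set) = 2 ^ n"
proof (induction n)
  case 0
  have "polys_below 0 = {0 :: bit poly}" by (auto simp: polys_below_iff)
  then show ?case by simp
next
  case (Suc n)
  have UNIV: "(UNIV :: bit set) = {0, 1}" by (auto intro: bit.exhaust)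
  have "inj_on (\<lambda>(a, f). pCons a f) (UNIV \<times> (polys_below n :: bit poly set))"
    by (auto simp: inj_on_def)
  then show ?case
    using Suc by (simp add: polys_below_Suc card_image card_cartesian_product UNIV)
qed

lemma finite_carrier_bit_vec: "finite (carrier_vec n :: bit vec set)"
  using bij_betw_finite[OF bij_betw_vec_of_poly, of n] card_polys_below by blast

section \<open>Growth of the kernels of powers of an irreducible polynomial\<close>

lemma irreducible_degree_pos:
  assumes "irreducible (\<phi> :: 'a :: field poly)"
  shows "degree \<phi> > 0"
proof -
  have "\<phi> \<noteq> 0" "\<not> \<phi> dvd 1" using assms by (auto simp: irreducible_def)
  then show ?thesis using is_unit_iff_degree by blast
qed

text \<open>
  A nonzero element of least degree generates the ideal. It divides \<open>\<phi>\<close>, but its degree is less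
  than that of \<open>\<phi>\<close>, so it is a unit. This replaces inverses in the field of polynomials
  modulo \<open>\<phi>\<close>.
\<close>
lemma irreducible_ideal_unit:
  fixes \<phi> f :: "'a :: field poly"
  assumes irr: "irreducible \<phi>"
    and diff: "\<And>g h. g \<in> I \<Longrightarrow> h \<in> I \<Longrightarrow> g - h \<in> I"
    and mult: "\<And>g h. h \<in> I \<Longrightarrow> g * h \<in> I"
    and \<phi>: "\<phi> \<in> I" and f: "f \<in> I" "f \<noteq> 0" "f \<in> polys_below (degree \<phi>)"
  shows "1 \<in> I"
proof -
  obtain g where g: "g \<in> I" "g \<noteq> 0" and min: "\<And>h. h \<in> I \<Longrightarrow> h \<noteq> 0 \<Longrightarrow> degree g \<le> degree h"
    using f ex_has_least_nat[of "\<lambda>g. g \<in> I \<and> g \<noteq> 0" f degree] by blast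
  have "\<phi> mod g \<in> I"
    using diff[OF \<phi> mult[OF g(1)], of "\<phi> div g"] by (simp add: minus_div_mult_eq_mod)
  then have "\<phi> mod g = 0"
    using min[of "\<phi> mod g"] degree_mod_less'[OF g(2), of \<phi>] by fastforce
  then obtain h where h: "\<phi> = g * h" by (auto simp: mod_eq_0_iff_dvd elim: dvdE)
  have "\<not> h dvd 1"
  proof
    assume "h dvd 1"
    moreover have "h \<noteq> 0" using h irr by auto
    ultimately have "degree \<phi> = degree g"
      using h g by (simp add: degree_mult_eq is_unit_iff_degree)
    then show False using min[OF f(1,2)] f by (auto simp: polys_below_iff)
  qed
  then have "g dvd 1" using irr h by (auto dest: irreducibleD)
  then obtain u where "1 = g * u" by (auto elim: dvdE)
  then show ?thesis using mult[OF g(1), of u] by (simp add: mult.commute)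
qed

text \<open>
  Closure under scalar multiples is automatic: the only scalars are 0 and 1.
\<close>
definition invariant_subspace :: "bit mat \<Rightarrow> bit vec set \<Rightarrow> bool" where
  "invariant_subspace A W \<longleftrightarrow> W \<subseteq> carrier_vec (dim_row A) \<and> 0\<^sub>v (dim_row A) \<in> W \<and>
     (\<forall>v\<in>W. \<forall>w\<in>W. v + w \<in> W) \<and> (\<forall>v\<in>W. A *\<^sub>v v \<in> W)"

lemma invariant_subspace_poly_act:
  assumes A: "A \<in> carrier_mat n n" and W: "invariant_subspace A W" and v: "v \<in> W"
  shows "poly_act A p v \<in> W"
proof -
  have vn: "v \<in> carrier_vec n" using A W v by (auto simp: invariant_subspace_def)
  have "c \<cdot>\<^sub>v v \<in> W" for c
  proof (cases c)
    case zero
    have "0 \<cdot>\<^sub>v v = 0\<^sub>v n" using vn by (intro eq_vecI) auto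
    then show ?thesis using zero A W by (auto simp: invariant_subspace_def)
  qed (use v in simp)
  then show ?thesis
    using A W by (induction p)
      (auto simp: poly_act_0[OF A vn] poly_act_pCons[OF A vn] invariant_subspace_def)
qed

text \<open>
  As \<open>\<phi>(A)\<close> maps \<open>V\<close> into \<open>W\<close>, the quotient of \<open>V\<close> by \<open>W\<close> is a vector space over the field
  of polynomials modulo \<open>\<phi>\<close>, which has \<open>2 ^ degree \<phi>\<close> elements; \<open>e\<close> is its dimension. A basis is built one vector at a time: for \<open>v\<close>
  outside \<open>W\<close>, the sum of \<open>W\<close> and the vectors \<open>f(A) v\<close> with \<open>f\<close> of degree below that of \<open>\<phi>\<close>
  is again invariant, and \<open>2 ^ degree \<phi>\<close> times as large.
\<close>
lemma invariant_subspace_index: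
  assumes A: "A \<in> carrier_mat n n" and irr: "irreducible \<phi>"
    and V: "invariant_subspace A V" and W: "invariant_subspace A W" "W \<subseteq> V"
    and \<phi>: "\<And>v. v \<in> V \<Longrightarrow> poly_act A \<phi> v \<in> W"
  shows "\<exists>e. card V = card W * (2 ^ degree \<phi>) ^ e"
  using W \<phi>
proof (induction "card (V - W)" arbitrary: W rule: less_induct)
  case less
  let ?d = "degree \<phi>"
  have Vn: "V \<subseteq> carrier_vec n" using A V by (auto simp: invariant_subspace_def)
  have finV: "finite V" using Vn finite_carrier_bit_vec finite_subset by blast
  show ?case
  proof (cases "V = W")
    case True
    then show ?thesis by (intro exI[of _ 0]) simp
  next
    case False
    then obtain v where v: "v \<in> V" "v \<notin> W" using less.prems(2) by blast
    have vn: "v \<in> carrier_vec n" using v Vn by blast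
    have \<phi>0: "\<phi> \<noteq> 0" using irr by auto
    have act_V: "poly_act A p u \<in> V" if "u \<in> V" for p u
      using invariant_subspace_poly_act[OF A V that] .
    have act_n: "poly_act A p v \<in> carrier_vec n" for p using poly_act_carrier[OF A vn] .
    have W_add: "x + y \<in> W" if "x \<in> W" "y \<in> W" for x y
      using less.prems(1) that by (auto simp: invariant_subspace_def)
    have W0: "0\<^sub>v n \<in> W" using less.prems(1) A by (auto simp: invariant_subspace_def)
    have act_W: "poly_act A p u \<in> W" if "u \<in> W" for p u
      using invariant_subspace_poly_act[OF A less.prems(1) that] .
    let ?I = "{p. poly_act A p v \<in> W}"
    \<comment> \<open>This makes the sums \<open>w + f(A) v\<close> with \<open>w\<close> in \<open>W\<close> pairwise distinct.\<close>
    have indep: "f = 0" if f: "poly_act A f v \<in> W" "f \<in> polys_below ?d" for f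
    proof (rule ccontr)
      assume "f \<noteq> 0"
      have "1 \<in> ?I"
      proof (rule irreducible_ideal_unit[OF irr, of ?I f])
        fix g h assume "g \<in> ?I" "h \<in> ?I"
        then show "g - h \<in> ?I" using W_add by (simp add: bit_poly_diff poly_act_add[OF A vn])
      next
        fix g h assume "h \<in> ?I"
        then show "g * h \<in> ?I" using act_W by (simp add: poly_act_mult[OF A vn])
      next
        show "\<phi> \<in> ?I" using less.prems(3)[OF v(1)] by simp
      qed (use f \<open>f \<noteq> 0\<close> in simp_all)
      then show False using v by (simp add: poly_act_1[OF A vn])
    qed
    let ?F = "\<lambda>(w, f). w + poly_act A f v"
    let ?W' = "?F ` (W \<times> polys_below ?d)"
    have inj: "inj_on ?F (W \<times> polys_below ?d)"
    proof (rule inj_onI, clarify)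
      fix w f w' f'
      assume w: "w \<in> W" "w' \<in> W" and f: "f \<in> polys_below ?d" "f' \<in> polys_below ?d"
        and eq: "w + poly_act A f v = w' + poly_act A f' v"
      have wn: "w \<in> carrier_vec n" "w' \<in> carrier_vec n" using w less.prems(2) Vn by auto
      have sw: "w + w' = poly_act A (f + f') v"
        using bit_vec_add_swap[OF eq wn(1) act_n wn(2) act_n] by (simp add: poly_act_add[OF A vn])
      have "f + f' = 0"
        using indep[of "f + f'"] sw[symmetric] W_add[OF w] add_polys_below[OF f] by simp
      then have "f = f'" using bit_poly_add_self[of f'] by (metis add_right_cancel)
      moreover have "w = w'"
        using sw \<open>f + f' = 0\<close> by (intro bit_vec_add_eq_0[OF wn]) (simp add: poly_act_0[OF A vn])
      ultimately show "w = w' \<and> f = f'" by simp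
    qed
    have sub: "W \<subseteq> ?W'"
    proof
      fix w assume w: "w \<in> W"
      then have "w = ?F (w, 0)" using less.prems(2) Vn by (auto simp: poly_act_0[OF A vn])
      then show "w \<in> ?W'" using w by (intro image_eqI[of _ _ "(w, 0)"]) auto
    qed
    have W'V: "?W' \<subseteq> V"
    proof clarify
      fix w f assume "w \<in> W"
      then show "w + poly_act A f v \<in> V"
        using V act_V[OF v(1)] less.prems(2) by (auto simp: invariant_subspace_def)
    qed
    have "?d > 0" by (rule irreducible_degree_pos[OF irr])
    then have "1 \<in> polys_below ?d" by (simp add: polys_below_iff)
    then have "v \<in> ?W'"
      using W0 vn by (intro image_eqI[of _ _ "(0\<^sub>v n, 1)"]) (auto simp: poly_act_1[OF A vn])
    have inv: "invariant_subspace A ?W'"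
      unfolding invariant_subspace_def
    proof (intro conjI ballI)
      show "?W' \<subseteq> carrier_vec (dim_row A)" using W'V Vn A by auto
      show "0\<^sub>v (dim_row A) \<in> ?W'" using W0 sub A by auto
    next
      fix x y assume "x \<in> ?W'" "y \<in> ?W'"
      then obtain w f w' f' where x: "x = w + poly_act A f v" "w \<in> W" "f \<in> polys_below ?d"
        and y: "y = w' + poly_act A f' v" "w' \<in> W" "f' \<in> polys_below ?d" by auto
      have wn: "w \<in> carrier_vec n" "w' \<in> carrier_vec n" using x y less.prems(2) Vn by auto
      have "x + y = (w + w') + poly_act A (f + f') v"
        using wn act_n[of f] act_n[of f'] unfolding x y poly_act_add[OF A vn]
        by (intro eq_vecI) (auto simp: algebra_simps)
      then show "x + y \<in> ?W'"
        using W_add[OF x(2) y(2)] add_polys_below[OF x(3) y(3)] by auto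
    next
      fix x assume "x \<in> ?W'"
      then obtain w f where x: "x = w + poly_act A f v" "w \<in> W" "f \<in> polys_below ?d" by auto
      have wn: "w \<in> carrier_vec n" using x less.prems(2) Vn by auto
      \<comment> \<open>Multiplying by \<open>X\<close> may raise the degree of \<open>f\<close> to that of \<open>\<phi>\<close>; the multiple of \<open>\<phi>\<close> maps \<open>v\<close> into \<open>W\<close>.\<close>
      let ?q = "pCons 0 f div \<phi>" and ?r = "pCons 0 f mod \<phi>"
      let ?w' = "A *\<^sub>v w + poly_act A \<phi> (poly_act A ?q v)"
      have "A *\<^sub>v x = A *\<^sub>v w + poly_act A (\<phi> * ?q + ?r) v"
        using x wn act_n A
        by (simp add: mult_add_distrib_mat_vec[OF A] poly_act_X[OF A vn])
      also have "poly_act A (\<phi> * ?q + ?r) v = poly_act A \<phi> (poly_act A ?q v) + poly_act A ?r v"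
        by (simp only: poly_act_add[OF A vn] poly_act_mult[OF A vn])
      also have "A *\<^sub>v w + \<dots> = ?w' + poly_act A ?r v"
        using wn act_n A poly_act_carrier[OF A act_n]
        by (intro assoc_add_vec[of _ n, symmetric]) auto
      finally have "A *\<^sub>v x = ?w' + poly_act A ?r v" .
      moreover have "A *\<^sub>v w \<in> W" using less.prems(1) x by (auto simp: invariant_subspace_def)
      then have "?w' \<in> W" using W_add less.prems(3) act_V[OF v(1)] by blast
      ultimately show "A *\<^sub>v x \<in> ?W'" using mod_polys_below[OF \<phi>0] by auto
    qed
    have "card (V - ?W') < card (V - W)"
      using finV sub v \<open>v \<in> ?W'\<close> by (intro psubset_card_mono) auto
    then obtain e where e: "card V = card ?W' * (2 ^ ?d) ^ e"
      using less.hyps[OF _ inv W'V] less.prems(3) sub by blast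
    have "card ?W' = card W * 2 ^ ?d"
      using card_polys_below by (simp add: card_image[OF inj] card_cartesian_product)
    then show ?thesis using e by (intro exI[of _ "Suc e"]) (simp add: mult.assoc)
  qed
qed

definition poly_kernel :: "bit mat \<Rightarrow> bit poly \<Rightarrow> bit vec set" where
  "poly_kernel A p = {v \<in> carrier_vec (dim_row A). poly_act A p v = 0\<^sub>v (dim_row A)}"

lemma poly_kernel_subset:
  assumes "A \<in> carrier_mat n n"
  shows "poly_kernel A p \<subseteq> carrier_vec n"
  using assms by (auto simp: poly_kernel_def)

lemma finite_poly_kernel: "finite (poly_kernel A p)"
  unfolding poly_kernel_def
  by (rule finite_subset[OF _ finite_carrier_bit_vec[of "dim_row A"]]) auto

lemma poly_kernel_add:
  assumes A: "A \<in> carrier_mat n n" and "v \<in> poly_kernel A p" "w \<in> poly_kernel A p"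
  shows "v + w \<in> poly_kernel A p"
  using assms by (auto simp: poly_kernel_def poly_act_add_vec[OF A])

lemma zero_poly_kernel:
  assumes A: "A \<in> carrier_mat n n"
  shows "0\<^sub>v n \<in> poly_kernel A p"
  using assms by (auto simp: poly_kernel_def poly_act_zero_vec[OF A])

lemma card_poly_kernel_pos:
  assumes A: "A \<in> carrier_mat n n"
  shows "card (poly_kernel A p) > 0"
  using zero_poly_kernel[OF A, of p] finite_poly_kernel[of A p] by (auto simp: card_gt_0_iff)

lemma invariant_subspace_poly_kernel:
  assumes A: "A \<in> carrier_mat n n"
  shows "invariant_subspace A (poly_kernel A p)"
proof -
  have "A *\<^sub>v v \<in> poly_kernel A p" if v: "v \<in> poly_kernel A p" for v
  proof -
    have vn: "v \<in> carrier_vec n" using poly_kernel_subset[OF A] v by blast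
    have "A *\<^sub>v v = poly_act A (monom 1 1) v"
      by (simp add: monom_Suc poly_act_X[OF A vn] poly_act_1[OF A vn])
    then have "poly_act A p (A *\<^sub>v v) = poly_act A (monom 1 1) (poly_act A p v)"
      by (metis poly_act_mult[OF A vn] mult.commute)
    then show ?thesis
      using v A vn by (auto simp: poly_kernel_def poly_act_zero_vec[OF A])
  qed
  then show ?thesis
    using A poly_kernel_add[OF A] zero_poly_kernel[OF A] poly_kernel_subset[OF A]
    unfolding invariant_subspace_def by auto
qed

lemma poly_act_in_poly_kernel_iff:
  assumes A: "A \<in> carrier_mat n n" and v: "v \<in> carrier_vec n"
  shows "poly_act A p v \<in> poly_kernel A q \<longleftrightarrow> v \<in> poly_kernel A (q * p)"
  using A v by (auto simp: poly_kernel_def poly_act_mult[OF A v] poly_act_carrier[OF A v])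

lemma poly_kernel_mono:
  assumes A: "A \<in> carrier_mat n n"
  shows "poly_kernel A p \<subseteq> poly_kernel A (q * p)"
  using A by (auto simp: poly_kernel_def poly_act_mult[OF A] poly_act_zero_vec[OF A])

text \<open>
  \<open>p(A)\<close> embeds the quotient of the kernels of \<open>p\<^sup>2 q\<close> and \<open>p q\<close> (at \<open>A\<close>) into that of the kernels of
  \<open>p q\<close> and \<open>q\<close>. To count without quotients, send \<open>(v, w)\<close> in the product of the kernels of
  \<open>p\<^sup>2 q\<close> and \<open>q\<close> to \<open>x = p(A) v + w\<close> together with the difference (which is the sum) of \<open>v\<close> and the
  first component of a chosen preimage of \<open>x\<close>. Both lie in the kernel of \<open>p q\<close>, and they determine \<open>v\<close> and \<open>w\<close>.
\<close>
lemma card_poly_kernel_log_concave: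
  assumes A: "A \<in> carrier_mat n n"
  shows "card (poly_kernel A (p * p * q)) * card (poly_kernel A q) \<le> (card (poly_kernel A (p * q)))\<^sup>2"
proof -
  let ?U = "poly_kernel A (p * p * q)" and ?V = "poly_kernel A (p * q)" and ?W = "poly_kernel A q"
  let ?F = "\<lambda>(v, w). poly_act A p v + w"
  define s where "s = (\<lambda>x. fst (inv_into (?U \<times> ?W) ?F x))"
  let ?G = "\<lambda>(v, w). (?F (v, w), v + s (?F (v, w)))"
  have U_n: "v \<in> carrier_vec n" if "v \<in> poly_kernel A r" for r v
    using poly_kernel_subset[OF A] that by blast
  have T: "poly_act A p v \<in> ?V" if "v \<in> ?U" for v
    using poly_act_in_poly_kernel_iff[OF A U_n[OF that], of p "p * q"] that by (simp add: ac_simps)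
  have s: "s (?F (v, w)) \<in> ?U \<and> v + s (?F (v, w)) \<in> ?V" if v: "v \<in> ?U" and w: "w \<in> ?W" for v w
  proof -
    have "inv_into (?U \<times> ?W) ?F (?F (v, w)) \<in> ?U \<times> ?W"
      using v w by (intro inv_into_into) auto
    moreover have "?F (inv_into (?U \<times> ?W) ?F (?F (v, w))) = ?F (v, w)"
      using v w by (intro f_inv_into_f) auto
    ultimately obtain v0 w0 where vw0: "s (?F (v, w)) = v0" "v0 \<in> ?U" "w0 \<in> ?W"
      and eq: "poly_act A p v0 + w0 = poly_act A p v + w"
      unfolding s_def by (cases "inv_into (?U \<times> ?W) ?F (?F (v, w))") auto
    have "poly_act A p v + poly_act A p v0 = w + w0"
      using bit_vec_add_swap[OF eq[symmetric]] v w vw0 U_n T by blast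
    then have "poly_act A p (v + v0) \<in> ?W"
      using poly_act_add_vec[OF A U_n[OF v] U_n[OF vw0(2)]] poly_kernel_add[OF A w vw0(3)] by simp
    then have "v + v0 \<in> ?V"
      using poly_act_in_poly_kernel_iff[OF A, of "v + v0" p q] U_n[OF v] U_n[OF vw0(2)]
      by (simp add: mult.commute)
    then show ?thesis using vw0 by simp
  qed
  have "?G ` (?U \<times> ?W) \<subseteq> ?V \<times> ?V"
    using T s poly_kernel_add[OF A] poly_kernel_mono[OF A, of q p] by fastforce
  moreover have "inj_on ?G (?U \<times> ?W)"
  proof (rule inj_onI, clarify)
    fix v w v' w'
    assume v: "v \<in> ?U" "v' \<in> ?U" and w: "w \<in> ?W" "w' \<in> ?W"
      and F: "poly_act A p v + w = poly_act A p v' + w'"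
      and eq: "v + s (poly_act A p v + w) = v' + s (poly_act A p v' + w')"
    have sn: "s (poly_act A p v + w) \<in> carrier_vec n" using s[OF v(1) w(1)] U_n by auto
    have "v + v' = 0\<^sub>v n"
      using bit_vec_add_swap[OF eq[folded F] U_n[OF v(1)] sn U_n[OF v(2)] sn] bit_vec_add_self[OF sn]
      by simp
    then have vv: "v = v'" using bit_vec_add_eq_0 U_n v by blast
    have Tn: "poly_act A p v' \<in> carrier_vec n" using T[OF v(2)] U_n by blast
    have "poly_act A p v' + poly_act A p v' = w + w'"
      using bit_vec_add_swap[OF F[unfolded vv] Tn _ Tn] w U_n by blast
    then have "w = w'" using bit_vec_add_eq_0 U_n w bit_vec_add_self[OF Tn] by metis
    then show "v = v' \<and> w = w'" using vv by simp
  qed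
  ultimately have "card (?U \<times> ?W) \<le> card (?V \<times> ?V)"
    using finite_poly_kernel by (intro card_inj_on_le[of ?G]) auto
  then show ?thesis by (simp add: card_cartesian_product power2_eq_square)
qed

text \<open>
  The function \<open>e\<close> is the conjugate of the partition of \<open>A\<close> at \<open>\<phi>\<close>. Its values are dimensions of
  quotients of successive kernels, and log-concavity of the sizes of the kernels makes it monotone.
\<close>
lemma card_poly_kernel_power_Suc:
  assumes A: "A \<in> carrier_mat n n" and irr: "irreducible \<phi>"
  shows "\<exists>e. antimono e \<and>
    (\<forall>j. card (poly_kernel A (\<phi> ^ Suc j)) = card (poly_kernel A (\<phi> ^ j)) * (2 ^ degree \<phi>) ^ e j)"
proof -
  let ?K = "\<lambda>j. poly_kernel A (\<phi> ^ j)" and ?Q = "2 ^ degree \<phi> :: nat"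
  have "\<exists>e. card (?K (Suc j)) = card (?K j) * ?Q ^ e" for j
  proof (rule invariant_subspace_index[OF A irr])
    show "invariant_subspace A (?K (Suc j))" "invariant_subspace A (?K j)"
      by (rule invariant_subspace_poly_kernel[OF A])+
    show "?K j \<subseteq> ?K (Suc j)"
      unfolding power_Suc by (rule poly_kernel_mono[OF A])
  next
    fix v assume v: "v \<in> ?K (Suc j)"
    then have "v \<in> carrier_vec n" using poly_kernel_subset[OF A] by blast
    then show "poly_act A \<phi> v \<in> ?K j"
      using poly_act_in_poly_kernel_iff[OF A, of v \<phi> "\<phi> ^ j"] v by (simp only: power_Suc2)
  qed
  then obtain e where e: "\<And>j. card (?K (Suc j)) = card (?K j) * ?Q ^ e j" by metis
  have "degree \<phi> > 0" by (rule irreducible_degree_pos[OF irr])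
  then have Q: "?Q > 1" using one_less_power[of "2 :: nat"] by simp
  have "e (Suc j) \<le> e j" for j
  proof -
    let ?c = "card (?K j)"
    have "?c * ?Q ^ e j * ?Q ^ e (Suc j) * ?c \<le> (?c * ?Q ^ e j)\<^sup>2"
      using card_poly_kernel_log_concave[OF A, of \<phi> "\<phi> ^ j"] e[of "Suc j"] e[of j]
      by (simp add: mult.assoc)
    then have "(?c * ?c * ?Q ^ e j) * ?Q ^ e (Suc j) \<le> (?c * ?c * ?Q ^ e j) * ?Q ^ e j"
      by (simp only: power2_eq_square ac_simps)
    then have "?Q ^ e (Suc j) \<le> ?Q ^ e j"
      using card_poly_kernel_pos[OF A] by simp
    then show ?thesis using Q power_le_imp_le_exp by blast
  qed
  then have "antimono e" by (rule decseq_SucI)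
  then show ?thesis using e by blast
qed

lemma poly_kernel_square:
  assumes B: "B \<in> carrier_mat n n"
  shows "poly_kernel (B * B) p = poly_kernel B (p\<^sup>2)"
  using B by (auto simp: poly_kernel_def poly_act_square_mat[OF B] pcompose_square_bit)

section \<open>Kernels of canonical matrices\<close>

lemma dim_companion_matrix [simp]:
  "dim_row (companion_matrix p) = degree p" "dim_col (companion_matrix p) = degree p"
  by (simp_all add: companion_matrix_def)

lemma card_poly_kernel_companion:
  assumes p: "p \<noteq> 0"
  shows "card (poly_kernel (companion_matrix p) q) = card {f \<in> polys_below (degree p). p dvd q * f}"
proof -
  have inj: "inj_on (vec_of_poly (degree p)) {f \<in> polys_below (degree p). p dvd q * f}"
    by (rule inj_on_subset[OF bij_betw_imp_inj_on[OF bij_betw_vec_of_poly]]) auto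
  have iff: "vec_of_poly (degree p) f \<in> poly_kernel (companion_matrix p) q \<longleftrightarrow> p dvd q * f"
    if f: "f \<in> polys_below (degree p)" for f
    by (simp add: poly_kernel_def poly_act_companion[OF p f]
        vec_of_poly_eq_0_iff[OF mod_polys_below[OF p]] mod_eq_0_iff_dvd)
  have "poly_kernel (companion_matrix p) q =
      vec_of_poly (degree p) ` {f \<in> polys_below (degree p). p dvd q * f}"
  proof (intro equalityI subsetI)
    fix v assume v: "v \<in> poly_kernel (companion_matrix p) q"
    then have "v \<in> carrier_vec (degree p)"
      using poly_kernel_subset[OF companion_matrix_carrier] by blast
    then obtain f where "f \<in> polys_below (degree p)" "v = vec_of_poly (degree p) f"
      by (rule carrier_vec_cases)
    then show "v \<in> vec_of_poly (degree p) ` {f \<in> polys_below (degree p). p dvd q * f}"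
      using v iff by blast
  qed (use iff in auto)
  then show ?thesis by (simp add: card_image[OF inj])
qed

lemma carrier_vec_append_cases:
  assumes "u \<in> carrier_vec (n + m)"
  obtains v w where "v \<in> carrier_vec n" "w \<in> carrier_vec m" "u = v @\<^sub>v w"
  using vec_first_last_append[OF assms] vec_first_carrier vec_last_carrier by metis

lemma card_poly_kernel_four_block:
  assumes A: "A \<in> carrier_mat n n" and D: "D \<in> carrier_mat m m"
  shows "card (poly_kernel (four_block_mat A (0\<^sub>m n m) (0\<^sub>m m n) D) p) =
    card (poly_kernel A p) * card (poly_kernel D p)"
proof -
  let ?M = "four_block_mat A (0\<^sub>m n m) (0\<^sub>m m n) D"
  have dims: "dim_row ?M = n + m" "dim_row A = n" "dim_row D = m" using A D by auto
  have zero: "(0\<^sub>v (n + m) :: bit vec) = 0\<^sub>v n @\<^sub>v 0\<^sub>v m" by (intro eq_vecI) auto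
  have iff: "v @\<^sub>v w \<in> poly_kernel ?M p \<longleftrightarrow> v \<in> poly_kernel A p \<and> w \<in> poly_kernel D p"
    if v: "v \<in> carrier_vec n" and w: "w \<in> carrier_vec m" for v w
  proof -
    have "poly_act ?M p (v @\<^sub>v w) = 0\<^sub>v (n + m) \<longleftrightarrow> poly_act A p v = 0\<^sub>v n \<and> poly_act D p w = 0\<^sub>v m"
      unfolding poly_act_four_block[OF A D v w] zero
      by (rule append_vec_eq[OF poly_act_carrier[OF A v]]) simp
    then show ?thesis using v w by (simp add: poly_kernel_def dims)
  qed
  have "poly_kernel ?M p = (\<lambda>(v, w). v @\<^sub>v w) ` (poly_kernel A p \<times> poly_kernel D p)"
  proof (intro equalityI subsetI)
    fix u assume u: "u \<in> poly_kernel ?M p"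
    then have "u \<in> carrier_vec (n + m)" by (simp add: poly_kernel_def dims)
    then obtain v w where "v \<in> carrier_vec n" "w \<in> carrier_vec m" "u = v @\<^sub>v w"
      by (rule carrier_vec_append_cases)
    then show "u \<in> (\<lambda>(v, w). v @\<^sub>v w) ` (poly_kernel A p \<times> poly_kernel D p)"
      using u iff by auto
  next
    fix u assume "u \<in> (\<lambda>(v, w). v @\<^sub>v w) ` (poly_kernel A p \<times> poly_kernel D p)"
    then obtain v w where vw: "v \<in> poly_kernel A p" "w \<in> poly_kernel D p" "u = v @\<^sub>v w" by auto
    then have "v \<in> carrier_vec n" "w \<in> carrier_vec m"
      using poly_kernel_subset[OF A] poly_kernel_subset[OF D] by blast+
    then show "u \<in> poly_kernel ?M p" using iff vw by blast
  qed
  moreover have "inj_on (\<lambda>(v, w). v @\<^sub>v w) (poly_kernel A p \<times> poly_kernel D p)"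
  proof (rule inj_onI, clarify)
    fix v w v' w'
    assume "v \<in> poly_kernel A p" "v' \<in> poly_kernel A p" and eq: "v @\<^sub>v w = v' @\<^sub>v w'"
    then have "v \<in> carrier_vec n" "v' \<in> carrier_vec n" using poly_kernel_subset[OF A] by blast+
    then show "v = v' \<and> w = w'" using append_vec_eq[of v n v'] eq by blast
  qed
  ultimately show ?thesis by (simp add: card_image card_cartesian_product)
qed

lemma diag_block_companion_carrier:
  "diag_block_mat (map companion_matrix ps) \<in> carrier_mat (sum_list (map degree ps)) (sum_list (map degree ps))"
  by (rule carrier_matI) (simp_all add: dim_diag_block_mat comp_def)

lemma card_poly_kernel_diag_block:
  assumes "\<And>p. p \<in> set ps \<Longrightarrow> p \<noteq> 0"
  shows "card (poly_kernel (diag_block_mat (map companion_matrix ps)) q) =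
    (\<Prod>p\<leftarrow>ps. card {f \<in> polys_below (degree p). p dvd q * f})"
  using assms
proof (induction ps)
  case Nil
  have "poly_kernel (0\<^sub>m 0 0) q = {0\<^sub>v 0}"
    using poly_act_zero_vec[of "0\<^sub>m 0 0" 0 q] by (auto simp: poly_kernel_def)
  then show ?case by simp
next
  case (Cons p ps)
  have C: "companion_matrix p \<in> carrier_mat (degree p) (degree p)" by simp
  let ?n = "sum_list (map degree ps)"
  have D: "diag_block_mat (map companion_matrix ps) \<in> carrier_mat ?n ?n"
    by (rule diag_block_companion_carrier)
  have "diag_block_mat (map companion_matrix (p # ps)) =
      four_block_mat (companion_matrix p) (0\<^sub>m (degree p) ?n) (0\<^sub>m ?n (degree p))
        (diag_block_mat (map companion_matrix ps))"
    using C D by (simp add: Let_def)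
  then show ?case
    using Cons by (simp add: card_poly_kernel_four_block[OF C D] card_poly_kernel_companion)
qed

lemma monic_irreducible_dvd_imp_eq:
  fixes \<phi> \<psi> :: "'a :: field poly"
  assumes "\<phi> \<in> monic_irreducibles" "\<psi> \<in> monic_irreducibles" "\<psi> dvd \<phi>"
  shows "\<psi> = \<phi>"
proof -
  obtain u where u: "\<phi> = \<psi> * u" using assms(3) by (auto elim: dvdE)
  have "u dvd 1" using assms u by (auto simp: monic_irreducibles_def irreducible_def)
  then obtain c where c: "u = [:c:]" by (auto simp: is_unit_poly_iff)
  have "lead_coeff u = 1"
    using assms u by (simp add: monic_irreducibles_def lead_coeff_mult)
  then show ?thesis using u c by simp
qed

text \<open>
  Modulo a power of \<open>\<psi>\<close> the powers of \<open>\<phi>\<close> are invertible, so blocks at other irreducible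
  polynomials contribute nothing to the kernel.
\<close>
lemma card_annihilated_other:
  fixes \<phi> \<psi> :: "bit poly"
  assumes \<phi>: "\<phi> \<in> monic_irreducibles" and \<psi>: "\<psi> \<in> monic_irreducibles" and ne: "\<phi> \<noteq> \<psi>"
  shows "card {f \<in> polys_below (degree (\<psi> ^ k)). \<psi> ^ k dvd \<phi> ^ j * f} = 1"
proof -
  have prime: "prime_elem \<psi>"
    using \<psi> field_poly_irreducible_imp_prime by (auto simp: monic_irreducibles_def)
  have "\<not> \<psi> dvd \<phi>" using monic_irreducible_dvd_imp_eq[OF \<phi> \<psi>] ne by auto
  then have nd: "\<not> \<psi> dvd \<phi> ^ j" using prime_elem_dvd_power[OF prime] by blast
  have "f = 0" if "f \<in> polys_below (degree (\<psi> ^ k))" "\<psi> ^ k dvd \<phi> ^ j * f" for f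
  proof -
    have "\<psi> ^ k dvd f"
      using prime_power_dvd_multD[OF prime that(2) _ nd] by (cases "k = 0") auto
    then show "f = 0" using polys_below_dvd_zero that(1) by blast
  qed
  then have "{f \<in> polys_below (degree (\<psi> ^ k)). \<psi> ^ k dvd \<phi> ^ j * f} = {0}" by auto
  then show ?thesis by simp
qed

text \<open>
  The polynomials in question are the multiples of \<open>\<phi> ^ (k - j)\<close>; truncated subtraction covers the
  case \<open>k < j\<close>, in which there is no condition.
\<close>
lemma card_annihilated_same:
  fixes \<phi> :: "bit poly"
  assumes \<phi>: "\<phi> \<noteq> 0"
  shows "card {f \<in> polys_below (degree (\<phi> ^ k)). \<phi> ^ k dvd \<phi> ^ j * f} = (2 ^ degree \<phi>) ^ min j k"
proof -
  let ?d = "degree \<phi>"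
  have deg: "degree (\<phi> ^ i) = i * ?d" for i using \<phi> by (simp add: degree_power_eq)
  have dvd_iff: "\<phi> ^ k dvd \<phi> ^ j * f \<longleftrightarrow> \<phi> ^ (k - j) dvd f" for f
  proof (cases "j \<le> k")
    case True
    then have "\<phi> ^ k = \<phi> ^ j * \<phi> ^ (k - j)" by (simp flip: power_add)
    then show ?thesis using \<phi> by simp
  qed (simp add: dvd_mult2 le_imp_power_dvd)
  have "{f \<in> polys_below (degree (\<phi> ^ k)). \<phi> ^ k dvd \<phi> ^ j * f} =
      (\<lambda>g. \<phi> ^ (k - j) * g) ` polys_below (min j k * ?d)"
  proof -
    have "\<phi> ^ (k - j) * g \<in> polys_below (degree (\<phi> ^ k)) \<longleftrightarrow> g \<in> polys_below (min j k * ?d)" for g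
    proof (cases "g = 0")
      case False
      have "k = (k - j) + min j k" by arith
      then have "k * ?d = (k - j) * ?d + min j k * ?d" by (metis add_mult_distrib)
      then show ?thesis using \<phi> False by (simp add: polys_below_iff degree_mult_eq deg)
    qed simp
    then show ?thesis unfolding dvd_iff by (auto elim!: dvdE)
  qed
  moreover have "inj_on (\<lambda>g. \<phi> ^ (k - j) * g) (polys_below (min j k * ?d))"
    using \<phi> by (auto simp: inj_on_def)
  ultimately show ?thesis
    using card_polys_below by (simp add: card_image mult.commute flip: power_mult)
qed

lemma partition_support:
  assumes "p \<in> partitions"
  shows "{i. p i \<noteq> 0} = {..<num_parts p}"
proof -
  have anti: "antimono p" and fin: "finite {i. p i \<noteq> 0}" using assms by (auto simp: partitions_def)
  have "\<exists>i. p i = 0"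
  proof (rule ccontr)
    assume "\<nexists>i. p i = 0"
    then have "{i. p i \<noteq> 0} = UNIV" by auto
    then show False using fin by simp
  qed
  then have "p (LEAST i. p i = 0) = 0" by (rule LeastI_ex)
  then have "{i. p i \<noteq> 0} = {..<LEAST i. p i = 0}"
    using antimonoD[OF anti] not_less_Least by (force simp: not_less[symmetric])
  then show ?thesis by (simp add: num_parts_def)
qed

lemma partition_nonzero_iff:
  assumes "p \<in> partitions"
  shows "p i \<noteq> 0 \<longleftrightarrow> i < num_parts p"
proof -
  have "i \<in> {i. p i \<noteq> 0} \<longleftrightarrow> i \<in> {..<num_parts p}" by (simp only: partition_support[OF assms])
  then show ?thesis by simp
qed

lemma sum_min_Suc_partition:
  assumes "p \<in> partitions"
  shows "(\<Sum>i<num_parts p. min (Suc j) (p i)) = (\<Sum>i<num_parts p. min j (p i)) + conjugate_partition p j"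
proof -
  have "i < num_parts p" if "Suc j \<le> p i" for i
    using partition_nonzero_iff[OF assms, of i] that by linarith
  then have "{i. Suc j \<le> p i} = {..<num_parts p} \<inter> {i. Suc j \<le> p i}" by blast
  then have "conjugate_partition p j = (\<Sum>i<num_parts p. if Suc j \<le> p i then 1 else 0)"
    by (simp add: conjugate_partition_def sum.If_cases)
  moreover have "min (Suc j) x = min j x + (if Suc j \<le> x then 1 else 0)" for x by arith
  ultimately show ?thesis by (simp only: sum.distrib)
qed

definition elementary_divisors :: "('a :: field poly \<Rightarrow> nat \<Rightarrow> nat) \<Rightarrow> 'a poly \<Rightarrow> 'a poly list" where
  "elementary_divisors \<Lambda> \<phi> = map (\<lambda>i. \<phi> ^ \<Lambda> \<phi> i) [0..<num_parts (\<Lambda> \<phi>)]"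

lemma concat_blocks:
  "concat (map (blocks \<Lambda>) \<phi>s) = map companion_matrix (concat (map (elementary_divisors \<Lambda>) \<phi>s))"
  by (induction \<phi>s) (simp_all add: blocks_def elementary_divisors_def)

lemma prod_list_map_concat:
  "(\<Prod>x\<leftarrow>concat xss. (f x :: nat)) = (\<Prod>xs\<leftarrow>xss. \<Prod>x\<leftarrow>xs. f x)"
  by (induction xss) simp_all

lemma prod_list_elementary_divisors:
  fixes g :: "'a :: field poly \<Rightarrow> nat"
  shows "(\<Prod>q\<leftarrow>elementary_divisors \<Lambda> \<phi>. g q) = (\<Prod>i<num_parts (\<Lambda> \<phi>). g (\<phi> ^ \<Lambda> \<phi> i))"
  using prod.distinct_set_conv_list[of "[0..<num_parts (\<Lambda> \<phi>)]" "\<lambda>i. g (\<phi> ^ \<Lambda> \<phi> i)"]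
  by (simp add: elementary_divisors_def comp_def atLeast0LessThan)

lemma card_poly_kernel_canonical:
  fixes \<Lambda> :: "bit poly \<Rightarrow> nat \<Rightarrow> nat"
  assumes \<phi>s: "distinct \<phi>s" "set \<phi>s \<subseteq> monic_irreducibles" and \<phi>: "\<phi> \<in> set \<phi>s"
  shows "card (poly_kernel (diag_block_mat (concat (map (blocks \<Lambda>) \<phi>s))) (\<phi> ^ j)) =
    (2 ^ degree \<phi>) ^ (\<Sum>i<num_parts (\<Lambda> \<phi>). min j (\<Lambda> \<phi> i))"
proof -
  let ?c = "\<lambda>q. card {f \<in> polys_below (degree q). q dvd \<phi> ^ j * f}"
  have ne: "\<psi> \<noteq> 0" if "\<psi> \<in> set \<phi>s" for \<psi>
    using that \<phi>s(2) by (auto simp: monic_irreducibles_def irreducible_def)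
  have inner: "(\<Prod>q\<leftarrow>elementary_divisors \<Lambda> \<psi>. ?c q) =
      (if \<psi> = \<phi> then (2 ^ degree \<phi>) ^ (\<Sum>i<num_parts (\<Lambda> \<phi>). min j (\<Lambda> \<phi> i)) else 1)"
    if \<psi>: "\<psi> \<in> set \<phi>s" for \<psi>
  proof (cases "\<psi> = \<phi>")
    case True
    then show ?thesis
      unfolding prod_list_elementary_divisors
      by (simp only: card_annihilated_same[OF ne[OF \<phi>]] power_sum if_True refl)
  next
    case False
    then have "?c (\<psi> ^ \<Lambda> \<psi> i) = 1" for i
      using card_annihilated_other[of \<phi> \<psi>] \<phi> \<psi> \<phi>s(2) by blast
    then show ?thesis using False unfolding prod_list_elementary_divisors by simp
  qed
  have "card (poly_kernel (diag_block_mat (concat (map (blocks \<Lambda>) \<phi>s))) (\<phi> ^ j)) =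
      (\<Prod>\<psi>\<leftarrow>\<phi>s. \<Prod>q\<leftarrow>elementary_divisors \<Lambda> \<psi>. ?c q)"
    unfolding concat_blocks
    by (subst card_poly_kernel_diag_block)
      (use ne in \<open>auto simp: prod_list_map_concat elementary_divisors_def comp_def\<close>)
  also have "\<dots> = (\<Prod>\<psi>\<in>set \<phi>s. \<Prod>q\<leftarrow>elementary_divisors \<Lambda> \<psi>. ?c q)"
    by (rule prod.distinct_set_conv_list[OF \<phi>s(1), symmetric])
  also have "\<dots> = (\<Prod>\<psi>\<in>set \<phi>s. if \<psi> = \<phi> then (2 ^ degree \<phi>) ^ (\<Sum>i<num_parts (\<Lambda> \<phi>). min j (\<Lambda> \<phi> i)) else 1)"
    by (intro prod.cong refl inner)
  also have "\<dots> = (2 ^ degree \<phi>) ^ (\<Sum>i<num_parts (\<Lambda> \<phi>). min j (\<Lambda> \<phi> i))"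
    using \<phi> by (simp add: prod.delta)
  finally show ?thesis .
qed

section \<open>The partitions of a square\<close>

text \<open>
  Two steps in the kernels of the powers of \<open>\<phi>(B)\<close> make one step for \<open>\<phi>(B\<^sup>2) = \<phi>(B)\<^sup>2\<close>.
\<close>
lemma conjugate_partition_of_square:
  fixes \<Lambda> :: "bit poly \<Rightarrow> nat \<Rightarrow> nat"
  assumes \<phi>s: "distinct \<phi>s" "set \<phi>s \<subseteq> monic_irreducibles" and \<phi>: "\<phi> \<in> set \<phi>s"
    and part: "\<Lambda> \<phi> \<in> partitions"
    and B: "B \<in> carrier_mat n n" "diag_block_mat (concat (map (blocks \<Lambda>) \<phi>s)) = B * B"
  shows "\<exists>e. antimono e \<and> (\<forall>j. conjugate_partition (\<Lambda> \<phi>) j = e (2 * j) + e (Suc (2 * j)))"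
proof -
  have irr: "irreducible \<phi>" using \<phi> \<phi>s by (auto simp: monic_irreducibles_def)
  let ?Q = "2 ^ degree \<phi> :: nat" and ?K = "\<lambda>j. card (poly_kernel B (\<phi> ^ j))"
  obtain e where e: "antimono e" "\<And>j. ?K (Suc j) = ?K j * ?Q ^ e j"
    using card_poly_kernel_power_Suc[OF B(1) irr] by blast
  have "degree \<phi> > 0" by (rule irreducible_degree_pos[OF irr])
  then have Q: "?Q > 1" using one_less_power[of "2 :: nat"] by simp
  have K: "?K (2 * j) = ?Q ^ (\<Sum>i<num_parts (\<Lambda> \<phi>). min j (\<Lambda> \<phi> i))" for j
    using card_poly_kernel_canonical[OF \<phi>s \<phi>, of \<Lambda> j]
    by (simp add: B(2) poly_kernel_square[OF B(1)] mult.commute flip: power_mult)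
  have "conjugate_partition (\<Lambda> \<phi>) j = e (2 * j) + e (Suc (2 * j))" for j
  proof -
    have "?K (2 * j) * ?Q ^ conjugate_partition (\<Lambda> \<phi>) j = ?K (2 * Suc j)"
      unfolding K sum_min_Suc_partition[OF part] power_add ..
    also have "\<dots> = ?K (2 * j) * ?Q ^ (e (2 * j) + e (Suc (2 * j)))"
      using e(2)[of "2 * j"] e(2)[of "Suc (2 * j)"] by (simp add: power_add)
    finally have "?Q ^ conjugate_partition (\<Lambda> \<phi>) j = ?Q ^ (e (2 * j) + e (Suc (2 * j)))"
      using card_poly_kernel_pos[OF B(1), of "\<phi> ^ (2 * j)"] by simp
    then show ?thesis using Q power_inject_exp by blast
  qed
  then show ?thesis using e(1) by blast
qed

text \<open>
  If the sums at \<open>j < k\<close> agree, then \<open>e (2 * j) \<ge> e (2 * j + 1) \<ge> e (2 * k) \<ge> e (2 * k + 1)\<close> leaves no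
  room for a strict inequality, and the common sum is even.
\<close>
lemma multiplicity_of_odd_paired_sum:
  assumes e: "antimono e" and p: "\<And>j. p j = e (2 * j) + e (Suc (2 * j))" and odd: "odd m"
  shows "multiplicity_of m p \<le> 1"
proof -
  have no: False if jk: "j < k" and eq: "p j = m" "p k = m" for j k
  proof -
    have "e (Suc (2 * j)) \<le> e (2 * j)" "e (2 * k) \<le> e (Suc (2 * j))" "e (Suc (2 * k)) \<le> e (2 * k)"
      using jk by (auto intro: antimonoD[OF e])
    then have "m = 2 * e (2 * k)" using p[of j] p[of k] eq by linarith
    then show False using odd by simp
  qed
  have "j = k" if "p j = m" "p k = m" for j k
    using no[of j k] no[of k j] that by (cases j k rule: linorder_cases) auto
  then have "card {j. p j = m} \<le> 1"
    by (cases "finite {j. p j = m}") (auto simp: card_le_Suc0_iff_eq)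
  then show ?thesis by (simp add: multiplicity_of_def)
qed

section \<open>Squares of matrices\<close>

lemma mat_pow_2: "A \<in> carrier_mat n n \<Longrightarrow> A ^\<^sub>m 2 = A * A"
  by (simp add: numeral_2_eq_2)

lemma squares_of_matrices_iff:
  "A \<in> squares_of_matrices n \<longleftrightarrow> (\<exists>B \<in> carrier_mat n n. A = B * B)"
proof -
  have "A \<in> squares_of_matrices n \<longleftrightarrow> (\<exists>B \<in> carrier_mat n n. A = B ^\<^sub>m 2)"
    unfolding squares_of_matrices_def by blast
  also have "\<dots> \<longleftrightarrow> (\<exists>B \<in> carrier_mat n n. A = B * B)"
    by (intro bex_cong refl) (simp only: mat_pow_2)
  finally show ?thesis .
qed

lemma square_in_squares_of_matrices: "B \<in> carrier_mat n n \<Longrightarrow> B * B \<in> squares_of_matrices n"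
  unfolding squares_of_matrices_iff by (rule bexI[of _ B]) (rule refl)

lemma squares_of_matrices_carrier: "A \<in> squares_of_matrices n \<Longrightarrow> A \<in> carrier_mat n n"
  unfolding squares_of_matrices_iff by (elim bexE) simp

lemma squares_of_matrices_similar:
  assumes A: "A \<in> squares_of_matrices n" and sim: "similar_mat A B"
  shows "B \<in> squares_of_matrices n"
proof -
  obtain C where C: "C \<in> carrier_mat n n" "A = C * C" using A by (auto simp: squares_of_matrices_iff)
  obtain P Q where wit: "similar_mat_wit B A P Q"
    using similar_mat_sym[OF sim] by (auto simp: similar_mat_def)
  have "B \<in> carrier_mat n n"
    using similar_matD[OF sim] squares_of_matrices_carrier[OF A] by auto
  note w = similar_mat_witD2[OF this wit]
  have P: "P \<in> carrier_mat n n" and Q: "Q \<in> carrier_mat n n" using w by auto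
  have "(P * C * Q) * (P * C * Q) = P * C * (Q * P) * (C * Q)"
    using P Q C(1) by (simp add: assoc_mult_mat[of _ n n _ n _ n])
  also have "\<dots> = B" using w P Q C by (simp add: assoc_mult_mat[of _ n n _ n _ n])
  finally have "B = (P * C * Q) * (P * C * Q)" ..
  moreover have "P * C * Q \<in> carrier_mat n n" using P Q C by simp
  ultimately show ?thesis using square_in_squares_of_matrices by metis
qed

lemma squares_of_matrices_four_block:
  assumes A: "A \<in> squares_of_matrices n" and D: "D \<in> squares_of_matrices m"
  shows "four_block_mat A (0\<^sub>m n m) (0\<^sub>m m n) D \<in> squares_of_matrices (n + m)"
proof -
  obtain B where B: "B \<in> carrier_mat n n" "A = B * B" using A by (auto simp: squares_of_matrices_iff)
  obtain E where E: "E \<in> carrier_mat m m" "D = E * E" using D by (auto simp: squares_of_matrices_iff)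
  let ?M = "four_block_mat B (0\<^sub>m n m) (0\<^sub>m m n) E"
  have "?M * ?M = four_block_mat A (0\<^sub>m n m) (0\<^sub>m m n) D"
    using B E by (subst mult_four_block_mat[of _ n n _ m _ m]) auto
  moreover have "?M \<in> carrier_mat (n + m) (n + m)" using B E by simp
  ultimately show ?thesis using square_in_squares_of_matrices[of ?M "n + m"] by metis
qed

text \<open>
  Leaves the size of the matrix implicit, which spares the bookkeeping of sizes when block matrices
  are put together.
\<close>
definition is_square_of_matrix :: "'a :: field mat \<Rightarrow> bool" where
  "is_square_of_matrix A \<longleftrightarrow> (\<exists>n. A \<in> squares_of_matrices n)"

lemma is_square_of_matrixD:
  "is_square_of_matrix A \<Longrightarrow> A \<in> carrier_mat n n \<Longrightarrow> A \<in> squares_of_matrices n"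
  using squares_of_matrices_carrier unfolding is_square_of_matrix_def by (metis carrier_matD(1))

lemma is_square_diag_block_append:
  assumes "is_square_of_matrix (diag_block_mat As)" "is_square_of_matrix (diag_block_mat Bs)"
  shows "is_square_of_matrix (diag_block_mat (As @ Bs))"
proof -
  obtain n m where n: "diag_block_mat As \<in> squares_of_matrices n"
    and m: "diag_block_mat Bs \<in> squares_of_matrices m"
    using assms by (auto simp: is_square_of_matrix_def)
  have "diag_block_mat As \<in> carrier_mat n n" "diag_block_mat Bs \<in> carrier_mat m m"
    using squares_of_matrices_carrier n m by blast+
  then have "diag_block_mat (As @ Bs) =
      four_block_mat (diag_block_mat As) (0\<^sub>m n m) (0\<^sub>m m n) (diag_block_mat Bs)"
    by (auto simp: diag_block_mat_append Let_def)
  then show ?thesis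
    using squares_of_matrices_four_block[OF n m] by (auto simp: is_square_of_matrix_def)
qed

lemma is_square_diag_block_Nil: "is_square_of_matrix (diag_block_mat [])"
proof -
  have "0\<^sub>m 0 0 = (0\<^sub>m 0 0 :: 'a mat) * 0\<^sub>m 0 0" by (intro eq_matI) auto
  then have "(0\<^sub>m 0 0 :: 'a mat) \<in> squares_of_matrices 0"
    using square_in_squares_of_matrices[of "0\<^sub>m 0 0 :: 'a mat" 0] by simp
  then show ?thesis by (auto simp: is_square_of_matrix_def)
qed

text \<open>
  The block of a zero part is the \<open>0 \<times> 0\<close> matrix; appending it makes an odd number of blocks even.
\<close>
lemma diag_block_mat_append_empty:
  assumes "diag_block_mat As \<in> carrier_mat n n" "B \<in> carrier_mat 0 0"
  shows "diag_block_mat (As @ [B]) = diag_block_mat As"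
  using assms by (intro eq_matI) (auto simp: diag_block_mat_append Let_def)

lemma similar_mat_if_injective_intertwiner:
  fixes A B P :: "'a :: field mat"
  assumes A: "A \<in> carrier_mat n n" and B: "B \<in> carrier_mat n n" and P: "P \<in> carrier_mat n n"
    and eq: "P * A = B * P"
    and inj: "\<And>v. v \<in> carrier_vec n \<Longrightarrow> P *\<^sub>v v = 0\<^sub>v n \<Longrightarrow> v = 0\<^sub>v n"
  shows "similar_mat A B"
proof -
  have "det P \<noteq> 0" using det_0_iff_vec_prod_zero_field[OF P] inj by blast
  then have "P \<in> Units (ring_mat TYPE('a) n ())" by (rule det_non_zero_imp_unit[OF P])
  then obtain Q where Q: "Q \<in> carrier_mat n n" "Q * P = 1\<^sub>m n" "P * Q = 1\<^sub>m n"
    by (auto simp: Units_def ring_mat_def)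
  have "A = Q * P * A" using A Q by simp
  also have "\<dots> = Q * (P * A)" by (rule assoc_mult_mat[OF Q(1) P A])
  also have "\<dots> = Q * B * P"
    unfolding eq by (rule assoc_mult_mat[OF Q(1) B P, symmetric])
  finally have "similar_mat_wit A B Q P"
    using A B P Q by (intro similar_mat_witI[of _ _ n]) auto
  then show ?thesis by (auto simp: similar_mat_def)
qed

text \<open>
  The order of \<open>\<phi>\<close> in \<open>f\<^sup>2\<close> is even and that in \<open>\<phi> g\<^sup>2\<close> is odd, so the order of the sum is the
  smaller of the two. The induction strips off one factor \<open>\<phi>\<close> of \<open>f\<close> and of \<open>g\<close> at a time and never
  mentions orders.
\<close>
lemma prime_power_dvd_square_add:
  fixes \<phi> f g :: "'a :: idom"
  assumes prime: "prime_elem \<phi>" and dvd: "\<phi> ^ (a + b) dvd f\<^sup>2 + \<phi> * g\<^sup>2" and ab: "b \<le> a" "a \<le> Suc b"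
  shows "\<phi> ^ a dvd f \<and> \<phi> ^ b dvd g"
  using dvd ab
proof (induction b arbitrary: a f g)
  case 0
  show ?case
  proof (cases "a = 0")
    case False
    then have a: "a = 1" using 0 by simp
    then have "\<phi> dvd f\<^sup>2" using 0 by (simp add: dvd_add_left_iff)
    then show ?thesis using a prime_elem_dvd_power[OF prime] by auto
  qed simp
next
  case (Suc b)
  have \<phi>0: "\<phi> \<noteq> 0" using prime by auto
  obtain a' where a: "a = Suc a'" using Suc.prems by (cases a) auto
  have pow: "\<phi> ^ (a + Suc b) = \<phi>\<^sup>2 * \<phi> ^ (a' + b)" by (simp add: a power2_eq_square)
  have dvd2: "\<phi>\<^sup>2 dvd f\<^sup>2 + \<phi> * g\<^sup>2" using Suc.prems(1) unfolding pow by (rule dvd_mult_left)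
  then have "\<phi> dvd f\<^sup>2 + \<phi> * g\<^sup>2" unfolding power2_eq_square[of \<phi>] by (rule dvd_mult_left)
  then have "\<phi> dvd f\<^sup>2" by (simp add: dvd_add_left_iff)
  then have "\<phi> dvd f" by (rule prime_elem_dvd_power[OF prime])
  then obtain f1 where f: "f = \<phi> * f1" by (rule dvdE)
  have "\<phi>\<^sup>2 dvd f\<^sup>2" unfolding f by (simp add: power_mult_distrib)
  then have "\<phi>\<^sup>2 dvd \<phi> * g\<^sup>2" using dvd2 by (simp add: dvd_add_right_iff)
  then have "\<phi> dvd g\<^sup>2" using \<phi>0 by (simp add: power2_eq_square[of \<phi>])
  then have "\<phi> dvd g" by (rule prime_elem_dvd_power[OF prime])
  then obtain g1 where g: "g = \<phi> * g1" by (rule dvdE)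
  have "f\<^sup>2 + \<phi> * g\<^sup>2 = \<phi>\<^sup>2 * (f1\<^sup>2 + \<phi> * g1\<^sup>2)"
    by (simp add: f g power_mult_distrib algebra_simps)
  then have "\<phi> ^ (a' + b) dvd f1\<^sup>2 + \<phi> * g1\<^sup>2"
    using Suc.prems(1) \<phi>0 unfolding pow by simp
  then have "\<phi> ^ a' dvd f1 \<and> \<phi> ^ b dvd g1" using Suc.prems by (intro Suc.IH) (auto simp: a)
  then show ?case by (simp add: a f g)
qed

lemma vec_of_poly_append:
  fixes f g :: "'a :: comm_ring_1 poly"
  assumes f: "f \<in> polys_below n"
  shows "vec_of_poly (n + m) (f + monom 1 n * g) = vec_of_poly n f @\<^sub>v vec_of_poly m g"
  using f by (intro eq_vecI) (auto simp: vec_of_poly_def coeff_monom_mult polys_below_def)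

lemma bit_poly_square_mult_X_mod:
  fixes f p :: "bit poly"
  obtains s where "monom 1 2 * f\<^sup>2 = ((monom 1 1 * f) mod p)\<^sup>2 + p\<^sup>2 * s\<^sup>2"
proof
  let ?r = "(monom 1 1 * f) mod p" and ?s = "(monom 1 1 * f) div p"
  have "monom 1 2 * f\<^sup>2 = (monom 1 1 * f)\<^sup>2" by (simp add: power_mult_distrib monom_power)
  also have "monom 1 1 * f = ?r + p * ?s" by (rule mod_mult_div_eq[symmetric])
  also have "(?r + p * ?s)\<^sup>2 = ?r\<^sup>2 + p\<^sup>2 * ?s\<^sup>2"
    by (simp only: bit_poly_power2_add power_mult_distrib)
  finally show "monom 1 2 * f\<^sup>2 = ?r\<^sup>2 + p\<^sup>2 * ?s\<^sup>2" .
qed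

text \<open>
  The intertwining map is \<open>(f, g) \<mapsto> f\<^sup>2 + \<phi> g\<^sup>2\<close> modulo \<open>\<phi> ^ (a + b)\<close>. It is well defined modulo
  \<open>\<phi> ^ a\<close> and \<open>\<phi> ^ b\<close> because both \<open>2 * a\<close> and \<open>2 * b + 1\<close> are at least \<open>a + b\<close>, and both spaces have
  the same dimension, so injectivity suffices.
\<close>
lemma companion_pair_is_square:
  fixes \<phi> :: "bit poly"
  assumes \<phi>: "irreducible \<phi>" and ab: "b \<le> a" "a \<le> Suc b"
  shows "is_square_of_matrix (diag_block_mat [companion_matrix (\<phi> ^ a), companion_matrix (\<phi> ^ b)])"
proof -
  have \<phi>0: "\<phi> \<noteq> 0" and prime: "prime_elem \<phi>"
    using \<phi> field_poly_irreducible_imp_prime by auto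
  let ?n = "degree (\<phi> ^ a)" and ?m = "degree (\<phi> ^ b)" and ?N = "degree (\<phi> ^ (a + b))"
  let ?C = "companion_matrix (\<phi> ^ (a + b))"
  let ?A = "companion_matrix (\<phi> ^ a)" and ?D = "companion_matrix (\<phi> ^ b)"
  let ?M = "four_block_mat ?A (0\<^sub>m ?n ?m) (0\<^sub>m ?m ?n) ?D"
  have N: "?N = ?n + ?m" using \<phi>0 by (simp add: degree_power_eq add_mult_distrib)
  define R where "R f g = (f\<^sup>2 + \<phi> * g\<^sup>2) mod \<phi> ^ (a + b)" for f g
  \<comment> \<open>A pair is encoded as \<open>f + X^n g\<close> with \<open>n = degree (\<phi> ^ a)\<close>, matching concatenation of vectors.\<close>
  define L where "L h = R (h mod monom 1 ?n) (h div monom 1 ?n)" for h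
  define P where "P = matrix_of_poly_map ?N ?N L"
  \<comment> \<open>In this form the map is visibly linear, as \<open>f\<^sup>2\<close> is \<open>f(X\<^sup>2)\<close>.\<close>
  have L_eq: "L h = (pcompose (h mod monom 1 ?n) (monom 1 2) +
      \<phi> * pcompose (h div monom 1 ?n) (monom 1 2)) mod \<phi> ^ (a + b)" for h
    by (simp add: L_def R_def pcompose_square_bit)
  have lin: "linear_poly_map L"
    unfolding linear_poly_map_def L_eq
    by (simp add: poly_mod_add_left poly_div_add_left mod_smult_left div_smult_left pcompose_add
        pcompose_smult algebra_simps flip: smult_add_right)
  have P: "P \<in> carrier_mat ?N ?N" by (simp add: P_def)
  have M: "?M \<in> carrier_mat ?N ?N" unfolding N by simp
  have below: "h mod \<phi> ^ k \<in> polys_below (degree (\<phi> ^ k))" for h k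
    using \<phi>0 by (intro mod_polys_below) simp
  have P_mult: "P *\<^sub>v (vec_of_poly ?n f @\<^sub>v vec_of_poly ?m g) = vec_of_poly ?N (R f g)"
    if f: "f \<in> polys_below ?n" and g: "g \<in> polys_below ?m" for f g
  proof -
    let ?h = "f + monom 1 ?n * g"
    have ne: "monom (1 :: bit) ?n \<noteq> 0" by simp
    have "?h mod monom 1 ?n = f"
      using mod_eq_self_polys_below[of f "monom 1 ?n"] f by (simp add: degree_monom_eq)
    moreover have "f div monom 1 ?n = 0"
      using f by (auto simp: polys_below_iff degree_monom_eq intro: div_poly_less)
    then have "?h div monom 1 ?n = g" using ne by simp
    moreover have "?h \<in> polys_below ?N"
      using f g unfolding N by (auto simp: polys_below_def coeff_monom_mult)
    ultimately show ?thesis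
      using matrix_of_poly_map_mult[OF lin, of ?h ?N ?N] vec_of_poly_append[OF f, of ?m g]
      by (simp add: P_def L_def N)
  qed
  have C2: "(?C * ?C) *\<^sub>v vec_of_poly ?N f = vec_of_poly ?N ((monom 1 2 * f) mod \<phi> ^ (a + b))"
    if f: "f \<in> polys_below ?N" for f
  proof -
    have "(?C * ?C) *\<^sub>v vec_of_poly ?N f = ?C *\<^sub>v (?C *\<^sub>v vec_of_poly ?N f)"
      by (rule assoc_mult_mat_vec) auto
    also have "\<dots> = vec_of_poly ?N ((monom 1 1 * ((monom 1 1 * f) mod \<phi> ^ (a + b))) mod \<phi> ^ (a + b))"
      by (simp only: companion_matrix_mult[OF f] companion_matrix_mult[OF below])
    also have "(monom 1 1 * ((monom 1 1 * f) mod \<phi> ^ (a + b))) mod \<phi> ^ (a + b) =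
        (monom 1 1 * (monom 1 1 * f)) mod \<phi> ^ (a + b)"
      by (rule mod_mult_right_eq)
    also have "monom 1 1 * (monom 1 1 * f) = monom 1 2 * f"
      by (simp add: mult_monom numeral_2_eq_2 flip: mult.assoc)
    finally show ?thesis .
  qed
  have intertwine: "P * ?M = (?C * ?C) * P"
  proof (rule mat_eqI_mult_vec[of _ ?N ?N])
    fix v :: "bit vec" assume "v \<in> carrier_vec ?N"
    then obtain v1 v2 where "v1 \<in> carrier_vec ?n" "v2 \<in> carrier_vec ?m" "v = v1 @\<^sub>v v2"
      unfolding N by (rule carrier_vec_append_cases)
    then obtain f g where fg: "f \<in> polys_below ?n" "g \<in> polys_below ?m"
      and v: "v = vec_of_poly ?n f @\<^sub>v vec_of_poly ?m g"
      using carrier_vec_cases by metis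
    have v_carrier: "v \<in> carrier_vec ?N" unfolding v N by simp
    let ?f = "(monom 1 1 * f) mod \<phi> ^ a" and ?g = "(monom 1 1 * g) mod \<phi> ^ b"
    have "?M *\<^sub>v v = (?A *\<^sub>v vec_of_poly ?n f) @\<^sub>v (?D *\<^sub>v vec_of_poly ?m g)"
      unfolding v by (rule mult_mat_vec_split) auto
    also have "\<dots> = vec_of_poly ?n ?f @\<^sub>v vec_of_poly ?m ?g"
      using companion_matrix_mult fg by metis
    finally have "(P * ?M) *\<^sub>v v = vec_of_poly ?N (R ?f ?g)"
      by (simp only: assoc_mult_mat_vec[OF P M v_carrier] P_mult[OF below below])
    also have "R ?f ?g = (monom 1 2 * R f g) mod \<phi> ^ (a + b)"
    proof -
      obtain s where f2: "monom 1 2 * f\<^sup>2 = ?f\<^sup>2 + (\<phi> ^ a)\<^sup>2 * s\<^sup>2"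
        by (rule bit_poly_square_mult_X_mod)
      obtain t where g2: "monom 1 2 * g\<^sup>2 = ?g\<^sup>2 + (\<phi> ^ b)\<^sup>2 * t\<^sup>2"
        by (rule bit_poly_square_mult_X_mod)
      have "monom 1 2 * (f\<^sup>2 + \<phi> * g\<^sup>2) = monom 1 2 * f\<^sup>2 + \<phi> * (monom 1 2 * g\<^sup>2)"
        by (simp only: distrib_left mult.left_commute)
      also have "\<dots> = (?f\<^sup>2 + \<phi> * ?g\<^sup>2) + (\<phi> ^ (a + a) * s\<^sup>2 + \<phi> ^ Suc (b + b) * t\<^sup>2)"
        unfolding f2 g2 by (simp add: power2_eq_square[of "\<phi> ^ _"] power_add algebra_simps)
      finally have eq: "monom 1 2 * (f\<^sup>2 + \<phi> * g\<^sup>2) =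
          (?f\<^sup>2 + \<phi> * ?g\<^sup>2) + (\<phi> ^ (a + a) * s\<^sup>2 + \<phi> ^ Suc (b + b) * t\<^sup>2)" .
      \<comment> \<open>This is where \<open>b \<le> a \<le> b + 1\<close> enters.\<close>
      have "\<phi> ^ (a + b) dvd \<phi> ^ (a + a) * s\<^sup>2 + \<phi> ^ Suc (b + b) * t\<^sup>2"
        using ab by (intro dvd_add dvd_mult2 le_imp_power_dvd) auto
      then obtain u where u: "\<phi> ^ (a + a) * s\<^sup>2 + \<phi> ^ Suc (b + b) * t\<^sup>2 = \<phi> ^ (a + b) * u"
        by (rule dvdE)
      have "(monom 1 2 * (f\<^sup>2 + \<phi> * g\<^sup>2)) mod \<phi> ^ (a + b) = R ?f ?g"
        unfolding eq u R_def by (rule mod_mult_self2)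
      then show ?thesis by (simp add: R_def mod_mult_right_eq)
    qed
    also have "vec_of_poly ?N \<dots> = (?C * ?C) *\<^sub>v (P *\<^sub>v v)"
      unfolding v P_mult[OF fg] by (rule C2[symmetric]) (simp only: R_def below)
    also have "\<dots> = ((?C * ?C) * P) *\<^sub>v v"
      by (rule assoc_mult_mat_vec[symmetric, OF _ P v_carrier]) auto
    finally show "(P * ?M) *\<^sub>v v = ((?C * ?C) * P) *\<^sub>v v" .
  qed (use P M in \<open>auto intro!: mult_carrier_mat\<close>)
  have inj: "v = 0\<^sub>v ?N" if v_carrier: "v \<in> carrier_vec ?N" and Pv: "P *\<^sub>v v = 0\<^sub>v ?N" for v
  proof -
    obtain v1 v2 where "v1 \<in> carrier_vec ?n" "v2 \<in> carrier_vec ?m" "v = v1 @\<^sub>v v2"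
      using v_carrier unfolding N by (rule carrier_vec_append_cases)
    then obtain f g where fg: "f \<in> polys_below ?n" "g \<in> polys_below ?m"
      and v: "v = vec_of_poly ?n f @\<^sub>v vec_of_poly ?m g"
      using carrier_vec_cases by metis
    have "R f g \<in> polys_below ?N" by (simp only: R_def below)
    then have "R f g = 0"
      using P_mult[OF fg] Pv v vec_of_poly_eq_0_iff by metis
    then have "\<phi> ^ (a + b) dvd f\<^sup>2 + \<phi> * g\<^sup>2" by (simp add: R_def mod_eq_0_iff_dvd)
    then have "\<phi> ^ a dvd f" "\<phi> ^ b dvd g" using prime_power_dvd_square_add[OF prime _ ab] by blast+
    then have "f = 0" "g = 0" using polys_below_dvd_zero fg by blast+
    then show ?thesis unfolding v N by (intro eq_vecI) auto
  qed
  have CC: "?C * ?C \<in> squares_of_matrices ?N"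
    by (intro square_in_squares_of_matrices companion_matrix_carrier)
  have "similar_mat ?M (?C * ?C)"
    by (rule similar_mat_if_injective_intertwiner[OF M squares_of_matrices_carrier[OF CC] P intertwine inj])
  then have "?M \<in> squares_of_matrices ?N"
    using squares_of_matrices_similar[OF CC] similar_mat_sym by blast
  moreover have "diag_block_mat [?A, ?D] = ?M"
    using diag_block_mat_singleton[of ?D] by (simp add: Let_def del: diag_block_mat_singleton)
  ultimately show ?thesis unfolding is_square_of_matrix_def by auto
qed

section \<open>Partitions whose parts pair up\<close>

text \<open>
  The entry \<open>j\<close> of the conjugate is \<open>2 * i + 1\<close> whenever \<open>p (2 * i + 1) \<le> j < p (2 * i)\<close>. A gap of
  more than 1 would therefore make this odd value occur twice.
\<close>
lemma paired_parts_if_odd_multiplicity_le_1: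
  assumes p: "p \<in> partitions"
    and mult: "\<And>i. i \<ge> 1 \<Longrightarrow> multiplicity_of (2 * i - 1) (conjugate_partition p) \<le> 1"
  shows "p (2 * i) \<le> Suc (p (Suc (2 * i)))"
proof (rule ccontr)
  assume "\<not> ?thesis"
  then have gap: "Suc (p (Suc (2 * i))) < p (2 * i)" by simp
  have anti: "p l \<le> p k" if "k \<le> l" for k l using p that by (auto simp: partitions_def antimono_def)
  have conj: "conjugate_partition p j = Suc (2 * i)" if j: "p (Suc (2 * i)) \<le> j" "j < p (2 * i)" for j
  proof -
    have "Suc j \<le> p k \<longleftrightarrow> k < Suc (2 * i)" for k
      using anti[of k "2 * i"] anti[of "Suc (2 * i)" k] j by (cases "k < Suc (2 * i)") auto
    then have "{k. Suc j \<le> p k} = {..<Suc (2 * i)}" by auto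
    then show ?thesis by (simp add: conjugate_partition_def)
  qed
  let ?J = "{j. conjugate_partition p j = Suc (2 * i)}"
  have "j < p 0" if "j \<in> ?J" for j
  proof (rule ccontr)
    assume "\<not> j < p 0"
    then have "\<not> Suc j \<le> p k" for k using anti[of 0 k] by simp
    then have "conjugate_partition p j = 0" by (simp add: conjugate_partition_def)
    then show False using that by simp
  qed
  then have "?J \<subseteq> {..<p 0}" by blast
  then have "finite ?J" by (rule finite_subset) simp
  moreover have "{p (Suc (2 * i)), Suc (p (Suc (2 * i)))} \<subseteq> ?J" using conj gap by auto
  ultimately have "card {p (Suc (2 * i)), Suc (p (Suc (2 * i)))} \<le> card ?J" by (rule card_mono)
  then show False using mult[of "Suc i"] by (simp add: multiplicity_of_def)
qed

lemma diag_block_paired_parts_is_square: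
  fixes \<phi> :: "bit poly"
  assumes \<phi>: "irreducible \<phi>" and anti: "antimono p" and pair: "\<And>i. p (2 * i) \<le> Suc (p (Suc (2 * i)))"
  shows "is_square_of_matrix (diag_block_mat (map (\<lambda>i. companion_matrix (\<phi> ^ p i)) [0..<2 * k]))"
proof (induction k)
  case 0
  show ?case using is_square_diag_block_Nil by simp
next
  case (Suc k)
  have "p (Suc (2 * k)) \<le> p (2 * k)" using anti by (auto intro: antimonoD)
  then have "is_square_of_matrix
      (diag_block_mat [companion_matrix (\<phi> ^ p (2 * k)), companion_matrix (\<phi> ^ p (Suc (2 * k)))])"
    using companion_pair_is_square[OF \<phi> _ pair] by blast
  from is_square_diag_block_append[OF Suc.IH this] show ?case
    by (simp del: diag_block_mat.simps)
qed

lemma blocks_is_square: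
  fixes \<Lambda> :: "bit poly \<Rightarrow> nat \<Rightarrow> nat"
  assumes \<phi>: "irreducible \<phi>" and part: "\<Lambda> \<phi> \<in> partitions"
    and pair: "\<And>i. \<Lambda> \<phi> (2 * i) \<le> Suc (\<Lambda> \<phi> (Suc (2 * i)))"
  shows "is_square_of_matrix (diag_block_mat (blocks \<Lambda> \<phi>))"
proof -
  let ?r = "num_parts (\<Lambda> \<phi>)"
  have anti: "antimono (\<Lambda> \<phi>)" using part by (simp add: partitions_def)
  note square = diag_block_paired_parts_is_square[of \<phi> "\<Lambda> \<phi>", OF \<phi> anti pair]
  show ?thesis
  proof (cases "even ?r")
    case True
    then have "2 * (?r div 2) = ?r" by simp
    then show ?thesis using square[of "?r div 2"] by (simp only: blocks_def)
  next
    case False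
    \<comment> \<open>The last block is paired with that of the zero part at index \<open>?r\<close>.\<close>
    then obtain k where "?r = 2 * k + 1" by (rule oddE)
    then have r: "2 * Suc k = Suc ?r" by simp
    have "\<Lambda> \<phi> ?r = 0" using partition_nonzero_iff[OF part, of ?r] by (metis less_irrefl)
    then have "companion_matrix (\<phi> ^ \<Lambda> \<phi> ?r) \<in> carrier_mat 0 0"
      using companion_matrix_carrier[of "\<phi> ^ \<Lambda> \<phi> ?r"] by simp
    moreover have "diag_block_mat (blocks \<Lambda> \<phi>) \<in> carrier_mat (sum_list (map degree (elementary_divisors \<Lambda> \<phi>)))
        (sum_list (map degree (elementary_divisors \<Lambda> \<phi>)))"
      using diag_block_companion_carrier[of "elementary_divisors \<Lambda> \<phi>"] concat_blocks[of \<Lambda> "[\<phi>]"] by simp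
    moreover have "map (\<lambda>i. companion_matrix (\<phi> ^ \<Lambda> \<phi> i)) [0..<2 * Suc k] =
        blocks \<Lambda> \<phi> @ [companion_matrix (\<phi> ^ \<Lambda> \<phi> ?r)]"
      unfolding r by (simp add: blocks_def)
    ultimately show ?thesis
      using square[of "Suc k"] by (simp only: diag_block_mat_append_empty)
  qed
qed

section \<open>The classes of squares\<close>

lemma canonical_matrix_carrier:
  fixes \<Lambda> :: "'a :: field poly \<Rightarrow> nat \<Rightarrow> nat"
  assumes \<Lambda>: "\<Lambda> \<in> class_data" and A: "A \<in> canonical_matrices \<Lambda>"
  shows "A \<in> carrier_mat (dim_data \<Lambda>) (dim_data \<Lambda>)"
proof -
  obtain \<phi>s where \<phi>s: "distinct \<phi>s" "set \<phi>s = nonempty_at \<Lambda>"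
    and A_eq: "A = diag_block_mat (concat (map (blocks \<Lambda>) \<phi>s))"
    using A by (auto simp: canonical_matrices_def)
  have degree: "sum_list (map degree (elementary_divisors \<Lambda> \<phi>)) = weight (\<Lambda> \<phi>) * degree \<phi>"
    if "\<phi> \<in> nonempty_at \<Lambda>" for \<phi>
  proof -
    have mem: "\<phi> \<in> monic_irreducibles" using that by (simp add: nonempty_at_def)
    then have "\<phi> \<noteq> 0" by (auto simp: monic_irreducibles_def)
    have part: "\<Lambda> \<phi> \<in> partitions" using \<Lambda> mem by (auto simp: class_data_def)
    have "sum_list (map degree (elementary_divisors \<Lambda> \<phi>)) =
        (\<Sum>i\<leftarrow>[0..<num_parts (\<Lambda> \<phi>)]. \<Lambda> \<phi> i * degree \<phi>)"
      using \<open>\<phi> \<noteq> 0\<close> by (simp add: elementary_divisors_def comp_def degree_power_eq)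
    also have "\<dots> = (\<Sum>i<num_parts (\<Lambda> \<phi>). \<Lambda> \<phi> i * degree \<phi>)"
      by (simp add: interv_sum_list_conv_sum_set_nat atLeast0LessThan)
    also have "\<dots> = weight (\<Lambda> \<phi>) * degree \<phi>"
      by (simp only: weight_def partition_support[OF part] sum_distrib_right)
    finally show ?thesis .
  qed
  have "sum_list (map degree (concat (map (elementary_divisors \<Lambda>) \<psi>s))) =
      (\<Sum>\<phi>\<leftarrow>\<psi>s. sum_list (map degree (elementary_divisors \<Lambda> \<phi>)))" for \<psi>s
    by (induction \<psi>s) simp_all
  then have "sum_list (map degree (concat (map (elementary_divisors \<Lambda>) \<phi>s))) =
      (\<Sum>\<phi>\<in>set \<phi>s. sum_list (map degree (elementary_divisors \<Lambda> \<phi>)))"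
    by (simp add: sum.distinct_set_conv_list[OF \<phi>s(1)])
  also have "\<dots> = dim_data \<Lambda>"
    unfolding \<phi>s(2) dim_data_def by (intro sum.cong refl degree)
  finally show ?thesis
    using diag_block_companion_carrier[of "concat (map (elementary_divisors \<Lambda>) \<phi>s)"]
    by (simp add: A_eq concat_blocks)
qed

lemma canonical_square_partitions:
  fixes \<Lambda> :: "bit poly \<Rightarrow> nat \<Rightarrow> nat"
  assumes \<Lambda>: "\<Lambda> \<in> class_data" and A: "A \<in> canonical_matrices \<Lambda>" "A \<in> squares_of_matrices n"
    and \<phi>: "\<phi> \<in> nonempty_at \<Lambda>" and odd: "odd m"
  shows "multiplicity_of m (conjugate_partition (\<Lambda> \<phi>)) \<le> 1"
proof -
  obtain \<phi>s where \<phi>s: "distinct \<phi>s" "set \<phi>s = nonempty_at \<Lambda>"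
    and A_eq: "A = diag_block_mat (concat (map (blocks \<Lambda>) \<phi>s))"
    using A(1) by (auto simp: canonical_matrices_def)
  obtain B where B: "B \<in> carrier_mat n n" "A = B * B"
    using A(2) by (auto simp: squares_of_matrices_iff)
  have sub: "set \<phi>s \<subseteq> monic_irreducibles" unfolding \<phi>s(2) by (auto simp: nonempty_at_def)
  have part: "\<Lambda> \<phi> \<in> partitions" using \<Lambda> \<phi> by (auto simp: class_data_def nonempty_at_def)
  obtain e where "antimono e" "\<And>j. conjugate_partition (\<Lambda> \<phi>) j = e (2 * j) + e (Suc (2 * j))"
    using conjugate_partition_of_square[OF \<phi>s(1) sub _ part B(1) B(2)[unfolded A_eq]] \<phi> \<phi>s(2) by blast
  then show ?thesis using multiplicity_of_odd_paired_sum odd by blast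
qed

lemma canonical_matrix_is_square:
  fixes \<Lambda> :: "bit poly \<Rightarrow> nat \<Rightarrow> nat"
  assumes \<Lambda>: "\<Lambda> \<in> class_data" and A: "A \<in> canonical_matrices \<Lambda>"
    and mult: "\<And>\<phi> i. \<phi> \<in> nonempty_at \<Lambda> \<Longrightarrow> i \<ge> 1 \<Longrightarrow>
      multiplicity_of (2 * i - 1) (conjugate_partition (\<Lambda> \<phi>)) \<le> 1"
  shows "A \<in> squares_of_matrices (dim_data \<Lambda>)"
proof -
  obtain \<phi>s where \<phi>s: "set \<phi>s = nonempty_at \<Lambda>"
    and A_eq: "A = diag_block_mat (concat (map (blocks \<Lambda>) \<phi>s))"
    using A by (auto simp: canonical_matrices_def)
  have block: "is_square_of_matrix (diag_block_mat (blocks \<Lambda> \<phi>))" if \<phi>: "\<phi> \<in> set \<phi>s" for \<phi>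
  proof (rule blocks_is_square)
    have mem: "\<phi> \<in> monic_irreducibles" using \<phi> \<phi>s by (simp add: nonempty_at_def)
    then show "irreducible \<phi>" by (simp add: monic_irreducibles_def)
    show part: "\<Lambda> \<phi> \<in> partitions" using \<Lambda> mem by (auto simp: class_data_def)
    show "\<Lambda> \<phi> (2 * i) \<le> Suc (\<Lambda> \<phi> (Suc (2 * i)))" for i
      using paired_parts_if_odd_multiplicity_le_1[OF part] mult \<phi> \<phi>s by blast
  qed
  have "is_square_of_matrix (diag_block_mat (concat (map (blocks \<Lambda>) \<psi>s)))" if "set \<psi>s \<subseteq> set \<phi>s" for \<psi>s
    using that
  proof (induction \<psi>s)
    case Nil
    show ?case using is_square_diag_block_Nil by simp
  next
    case (Cons \<phi> \<psi>s)
    then show ?case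
      using is_square_diag_block_append[OF block[of \<phi>], of "concat (map (blocks \<Lambda>) \<psi>s)"] by simp
  qed
  then have "is_square_of_matrix A" unfolding A_eq by blast
  then show ?thesis using is_square_of_matrixD canonical_matrix_carrier[OF \<Lambda> A] by blast
qed

lemma similarity_class_subset_squares:
  "A \<in> squares_of_matrices n \<Longrightarrow> similarity n `` {A} \<subseteq> squares_of_matrices n"
  using squares_of_matrices_similar by (auto simp: similarity_def)

lemma mem_similarity_class: "A \<in> carrier_mat n n \<Longrightarrow> A \<in> similarity n `` {A}"
  by (simp add: similarity_def similar_mat_refl)

lemma similarity_class_in_conjugacy_classes:
  "A \<in> carrier_mat n n \<Longrightarrow> similarity n `` {A} \<in> conjugacy_classes n"
  unfolding conjugacy_classes_def by (rule quotientI)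

lemma union_of_conjugacy_classes_squares:
  "union_of_conjugacy_classes n (squares_of_matrices n)"
  unfolding union_of_conjugacy_classes_def
proof (intro exI conjI)
  let ?K = "(\<lambda>A. similarity n `` {A}) ` squares_of_matrices n"
  show "?K \<subseteq> conjugacy_classes n"
    using similarity_class_in_conjugacy_classes squares_of_matrices_carrier by blast
  show "squares_of_matrices n = \<Union>?K"
  proof (intro equalityI subsetI)
    fix A assume A: "A \<in> squares_of_matrices n"
    then have "A \<in> similarity n `` {A}" using mem_similarity_class squares_of_matrices_carrier by blast
    then show "A \<in> \<Union>?K" using A by blast
  next
    fix A assume "A \<in> \<Union>?K"
    then obtain B where "B \<in> squares_of_matrices n" "A \<in> similarity n `` {B}" by blast
    then show "A \<in> squares_of_matrices n" using similarity_class_subset_squares by blast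
  qed
qed

theorem theorem1:
  shows "(\<forall>n\<ge>1. union_of_conjugacy_classes n (squares_of_matrices n :: bit mat set)) \<and>
    partition_uniform (squares_of_matrices :: nat \<Rightarrow> bit mat set)
      ({p \<in> partitions. \<forall>i\<ge>1. multiplicity_of (2 * i - 1) (conjugate_partition p) \<le> 1}
        \<union> {empty_partition})"
proof
  show "\<forall>n\<ge>1. union_of_conjugacy_classes n (squares_of_matrices n :: bit mat set)"
    using union_of_conjugacy_classes_squares by blast
  let ?S = "{p \<in> partitions. \<forall>i\<ge>1. multiplicity_of (2 * i - 1) (conjugate_partition p) \<le> 1}
        \<union> {empty_partition}"
  have "(\<exists>K \<in> conjugacy_classes n. K \<subseteq> squares_of_matrices n \<and> specifies \<Lambda> K) \<longleftrightarrow>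
      dim_data \<Lambda> = n \<and> (\<forall>\<phi> \<in> monic_irreducibles. \<Lambda> \<phi> \<in> ?S)"
    if \<Lambda>: "\<Lambda> \<in> class_data" for n and \<Lambda> :: "bit poly \<Rightarrow> nat \<Rightarrow> nat"
  proof
    assume "\<exists>K \<in> conjugacy_classes n. K \<subseteq> squares_of_matrices n \<and> specifies \<Lambda> K"
    then obtain A where A: "A \<in> canonical_matrices \<Lambda>" "A \<in> squares_of_matrices n"
      unfolding specifies_def by blast
    have "dim_data \<Lambda> = n"
      using canonical_matrix_carrier[OF \<Lambda> A(1)] squares_of_matrices_carrier[OF A(2)]
      by (metis carrier_matD(1))
    moreover have "\<Lambda> \<phi> \<in> ?S" if \<phi>: "\<phi> \<in> monic_irreducibles" for \<phi>
    proof (cases "\<phi> \<in> nonempty_at \<Lambda>")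
      case True
      have "\<Lambda> \<phi> \<in> partitions" using \<Lambda> \<phi> by (auto simp: class_data_def)
      moreover have "multiplicity_of (2 * i - 1) (conjugate_partition (\<Lambda> \<phi>)) \<le> 1" if "i \<ge> 1" for i
        using that by (intro canonical_square_partitions[OF \<Lambda> A True]) simp
      ultimately show ?thesis by blast
    qed (use \<phi> in \<open>simp add: nonempty_at_def\<close>)
    ultimately show "dim_data \<Lambda> = n \<and> (\<forall>\<phi> \<in> monic_irreducibles. \<Lambda> \<phi> \<in> ?S)" by blast
  next
    assume R: "dim_data \<Lambda> = n \<and> (\<forall>\<phi> \<in> monic_irreducibles. \<Lambda> \<phi> \<in> ?S)"
    have "finite (nonempty_at \<Lambda>)" using \<Lambda> by (simp add: class_data_def)
    then obtain \<phi>s where "set \<phi>s = nonempty_at \<Lambda>" "distinct \<phi>s" using finite_distinct_list by blast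
    then obtain A where A: "A \<in> canonical_matrices \<Lambda>" unfolding canonical_matrices_def by blast
    have "A \<in> squares_of_matrices n"
      using R canonical_matrix_is_square[OF \<Lambda> A] by (auto simp: nonempty_at_def)
    have carrier: "A \<in> carrier_mat n n" by (rule squares_of_matrices_carrier) fact
    show "\<exists>K \<in> conjugacy_classes n. K \<subseteq> squares_of_matrices n \<and> specifies \<Lambda> K"
    proof (intro bexI conjI)
      show "similarity n `` {A} \<subseteq> squares_of_matrices n"
        by (rule similarity_class_subset_squares) fact
      show "specifies \<Lambda> (similarity n `` {A})"
        unfolding specifies_def using A mem_similarity_class[OF carrier] by (rule bexI[rotated])
    qed (rule similarity_class_in_conjugacy_classes[OF carrier])
  qed
  then show "partition_uniform (squares_of_matrices :: nat \<Rightarrow> bit mat set) ?S"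
    unfolding partition_uniform_def by blast
qed

end
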